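(* Let $\mathfrak{R}$ be a locally finite $\mathbb{K}$-ringoid, $\mathcal{B}=\{\mathcal{B}_i\}_{i<\alpha}$ an exhaustive admissible family of subcategories of $\mathfrak{R}$, $\Delta$ its standard modules, and $M\in\mathrm{Mod}_\rho(\mathfrak{R})$. The following are equivalent: (a) $M\in\mathcal{F}_f(\Delta)$; (b) there is $i_0<\alpha$ with $\tau_j(M)=M$ for all $j$ with $i_0\le j<\alpha$, the set $\{i<\alpha : \tau_i(M)/\overline{\tau}_i(M)\neq 0\}$ is finite, and $\tau_i(M)/\overline{\tau}_i(M)\in\Delta(i)^\oplus$ for every $i<\alpha$.
   Context: $\mathbb{K}$ commutative ring; $\mathbb{K}$-ringoid: skeletally small category with $\mathbb{K}$-module Hom-sets and bilinear composition. Right $\mathfrak{R}$-modules: additive contravariant functors $\mathfrak{R}\to\mathrm{Ab}$ (category $\mathrm{Mod}_\rho(\mathfrak{R})$); $Y(e):=\mathrm{Hom}_\mathfrak{R}(-,e)$. Local object: local endomorphism ring; $\mathrm{ind}(\mathcal{B})$: isoclasses of local objects of $\mathcal{B}$; $\mathrm{add}$: direct summands of finite direct sums. Locally finite: Hom-sets of finite $\mathbb{K}$-length and Krull–Schmidt. Trace $\mathrm{Tr}_\mathcal{X}(M)$: sum of images of all morphisms $X\to M$, $X\in\mathcal{X}$. Exhaustive admissible family: $\{\mathcal{B}_i\}_{i<\alpha}$ ($\alpha$ ordinal) full subcategories with $\mathrm{add}(\mathcal{B}_i)=\mathcal{B}_i$, increasing, union $\mathfrak{R}$, nonempty sections $\sigma_i(\mathcal{B}):=\mathrm{ind}(\mathcal{B}_i)\setminus\bigcup_{j<i}\mathrm{ind}(\mathcal{B}_j)$.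 $\overline{P}(j):=\bigoplus_{r\in\sigma_j(\mathcal{B})}Y(r)$; $\tau_i(M):=\mathrm{Tr}_{\bigoplus_{j\le i}\overline{P}(j)}(M)$ and $\overline{\tau}_i(M):=\mathrm{Tr}_{\bigoplus_{j<i}\overline{P}(j)}(M)$; $\Delta_e(i):=Y(e)/\overline{\tau}_i(Y(e))$ for $e\in\sigma_i(\mathcal{B})$; $\Delta(i):=\{\Delta_e(i)\}_{e\in\sigma_i(\mathcal{B})}$, $\Delta:=\bigcup_i\Delta(i)$. $\mathcal{X}^\oplus$: finite direct sums of members of $\mathcal{X}$ (including $0$); $\mathcal{F}_f(\mathcal{X})$: modules $M$ with a finite chain $0=M_0\subseteq\cdots\subseteq M_n=M$ with $M_k/M_{k-1}\in\mathcal{X}^\oplus$. *)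

theory Defs
  imports Main
begin

text \<open>A K-ringoid: a (skeletally small) category whose objects are the set Ob,
  with Hom-sets Hom x y (all morphisms live in one HOL type 'h), composition
  cmp g f (= g after f), identities idm, and on each Hom-set a K-module
  structure (hadd, hzero x y, hneg, hsmult); composition is K-bilinear.\<close>

record ('o, 'h, 'k) ringoid =
  Ob :: "'o set"
  Hom :: "'o \<Rightarrow> 'o \<Rightarrow> 'h set"
  cmp :: "'h \<Rightarrow> 'h \<Rightarrow> 'h"
  idm :: "'o \<Rightarrow> 'h"
  hadd :: "'h \<Rightarrow> 'h \<Rightarrow> 'h"
  hzero :: "'o \<Rightarrow> 'o \<Rightarrow> 'h"
  hneg :: "'h \<Rightarrow> 'h"
  hsmult :: "'k \<Rightarrow> 'h \<Rightarrow> 'h"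

definition abgrp_on :: "'a set \<Rightarrow> ('a \<Rightarrow> 'a \<Rightarrow> 'a) \<Rightarrow> 'a \<Rightarrow> ('a \<Rightarrow> 'a) \<Rightarrow> bool" where
  "abgrp_on A add z neg \<longleftrightarrow>
     z \<in> A \<and> (\<forall>a\<in>A. \<forall>b\<in>A. add a b \<in> A) \<and> (\<forall>a\<in>A. neg a \<in> A) \<and>
     (\<forall>a\<in>A. \<forall>b\<in>A. \<forall>c\<in>A. add (add a b) c = add a (add b c)) \<and>
     (\<forall>a\<in>A. \<forall>b\<in>A. add a b = add b a) \<and>
     (\<forall>a\<in>A. add z a = a) \<and> (\<forall>a\<in>A. add (neg a) a = z)"

definition Kmod_on :: "'a set \<Rightarrow> ('a \<Rightarrow> 'a \<Rightarrow> 'a) \<Rightarrow> 'a \<Rightarrow> ('a \<Rightarrow> 'a)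
     \<Rightarrow> ('k::comm_ring_1 \<Rightarrow> 'a \<Rightarrow> 'a) \<Rightarrow> bool" where
  "Kmod_on A add z neg sm \<longleftrightarrow> abgrp_on A add z neg \<and>
     (\<forall>k. \<forall>a\<in>A. sm k a \<in> A) \<and>
     (\<forall>k. \<forall>a\<in>A. \<forall>b\<in>A. sm k (add a b) = add (sm k a) (sm k b)) \<and>
     (\<forall>k l. \<forall>a\<in>A. sm (k + l) a = add (sm k a) (sm l a)) \<and>
     (\<forall>k l. \<forall>a\<in>A. sm (k * l) a = sm k (sm l a)) \<and>
     (\<forall>a\<in>A. sm 1 a = a)"

definition K_ringoid :: "('o, 'h, 'k::comm_ring_1) ringoid \<Rightarrow> bool" where
  "K_ringoid R \<longleftrightarrow>
     (\<forall>x\<in>Ob R. \<forall>y\<in>Ob R. Kmod_on (Hom R x y) (hadd R) (hzero R x y) (hneg R) (hsmult R)) \<and>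
     (\<forall>x\<in>Ob R. \<forall>y\<in>Ob R. \<forall>x'\<in>Ob R. \<forall>y'\<in>Ob R.
        Hom R x y \<inter> Hom R x' y' \<noteq> {} \<longrightarrow> x = x' \<and> y = y') \<and>
     (\<forall>x\<in>Ob R. idm R x \<in> Hom R x x) \<and>
     (\<forall>x\<in>Ob R. \<forall>y\<in>Ob R. \<forall>z\<in>Ob R. \<forall>f\<in>Hom R x y. \<forall>g\<in>Hom R y z.
        cmp R g f \<in> Hom R x z) \<and>
     (\<forall>x\<in>Ob R. \<forall>y\<in>Ob R. \<forall>f\<in>Hom R x y.
        cmp R (idm R y) f = f \<and> cmp R f (idm R x) = f) \<and>
     (\<forall>w\<in>Ob R. \<forall>x\<in>Ob R. \<forall>y\<in>Ob R. \<forall>z\<in>Ob R.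
        \<forall>f\<in>Hom R w x. \<forall>g\<in>Hom R x y. \<forall>h\<in>Hom R y z.
        cmp R h (cmp R g f) = cmp R (cmp R h g) f) \<and>
     (\<forall>x\<in>Ob R. \<forall>y\<in>Ob R. \<forall>z\<in>Ob R. \<forall>f\<in>Hom R x y. \<forall>f'\<in>Hom R x y.
        \<forall>g\<in>Hom R y z. \<forall>g'\<in>Hom R y z. \<forall>k.
        cmp R (hadd R g g') f = hadd R (cmp R g f) (cmp R g' f) \<and>
        cmp R g (hadd R f f') = hadd R (cmp R g f) (cmp R g f') \<and>
        cmp R (hsmult R k g) f = hsmult R k (cmp R g f) \<and>
        cmp R g (hsmult R k f) = hsmult R k (cmp R g f))"

definition Ksub :: "('o, 'h, 'k::comm_ring_1) ringoid \<Rightarrow> 'o \<Rightarrow> 'o \<Rightarrow> 'h set \<Rightarrow> bool" where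
  "Ksub R x y S \<longleftrightarrow> S \<subseteq> Hom R x y \<and> hzero R x y \<in> S \<and>
     (\<forall>a\<in>S. \<forall>b\<in>S. hadd R a b \<in> S) \<and> (\<forall>k. \<forall>a\<in>S. hsmult R k a \<in> S)"

definition finite_Klength :: "('o, 'h, 'k::comm_ring_1) ringoid \<Rightarrow> 'o \<Rightarrow> 'o \<Rightarrow> bool" where
  "finite_Klength R x y \<longleftrightarrow>
     (\<exists>n::nat. \<forall>C::nat \<Rightarrow> 'h set. (\<forall>k. Ksub R x y (C k)) \<longrightarrow>
        \<not> (\<forall>k<n. C k \<subset> C (Suc k)))"

definition hsum :: "('o, 'h, 'k) ringoid \<Rightarrow> 'o \<Rightarrow> 'o \<Rightarrow> 'h list \<Rightarrow> 'h" where
  "hsum R x y fs = foldr (hadd R) fs (hzero R x y)"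

definition biprod_of :: "('o, 'h, 'k) ringoid \<Rightarrow> 'o \<Rightarrow> 'o list \<Rightarrow> bool" where
  "biprod_of R s xs \<longleftrightarrow> s \<in> Ob R \<and> set xs \<subseteq> Ob R \<and>
     (\<exists>ins prs. length ins = length xs \<and> length prs = length xs \<and>
        (\<forall>k<length xs. ins ! k \<in> Hom R (xs ! k) s \<and> prs ! k \<in> Hom R s (xs ! k)) \<and>
        (\<forall>k<length xs. \<forall>l<length xs.
            cmp R (prs ! k) (ins ! l) = (if k = l then idm R (xs ! k) else hzero R (xs ! l) (xs ! k))) \<and>
        hsum R s s (map (\<lambda>k. cmp R (ins ! k) (prs ! k)) [0..<length xs]) = idm R s)"

definition summand :: "('o, 'h, 'k) ringoid \<Rightarrow> 'o \<Rightarrow> 'o \<Rightarrow> bool" where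
  "summand R x y \<longleftrightarrow> x \<in> Ob R \<and> y \<in> Ob R \<and>
     (\<exists>i\<in>Hom R x y. \<exists>p\<in>Hom R y x. cmp R p i = idm R x)"

definition add_cl :: "('o, 'h, 'k) ringoid \<Rightarrow> 'o set \<Rightarrow> 'o set" where
  "add_cl R S = {y \<in> Ob R. \<exists>xs s. set xs \<subseteq> S \<and> biprod_of R s xs \<and> summand R y s}"

definition is_unit_end :: "('o, 'h, 'k) ringoid \<Rightarrow> 'o \<Rightarrow> 'h \<Rightarrow> bool" where
  "is_unit_end R e a \<longleftrightarrow> (\<exists>b\<in>Hom R e e. cmp R a b = idm R e \<and> cmp R b a = idm R e)"

definition local_obj :: "('o, 'h, 'k) ringoid \<Rightarrow> 'o \<Rightarrow> bool" where
  "local_obj R e \<longleftrightarrow> e \<in> Ob R \<and> idm R e \<noteq> hzero R e e \<and>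
     (\<forall>a\<in>Hom R e e. is_unit_end R e a \<or> is_unit_end R e (hadd R (idm R e) (hneg R a)))"

definition Krull_Schmidt :: "('o, 'h, 'k) ringoid \<Rightarrow> bool" where
  "Krull_Schmidt R \<longleftrightarrow>
     (\<forall>x\<in>Ob R. \<exists>xs. (\<forall>y\<in>set xs. local_obj R y) \<and> biprod_of R x xs)"

definition locally_finite :: "('o, 'h, 'k::comm_ring_1) ringoid \<Rightarrow> bool" where
  "locally_finite R \<longleftrightarrow> K_ringoid R \<and>
     (\<forall>x\<in>Ob R. \<forall>y\<in>Ob R. finite_Klength R x y) \<and> Krull_Schmidt R"

definition iso_obj :: "('o, 'h, 'k) ringoid \<Rightarrow> 'o \<Rightarrow> 'o \<Rightarrow> bool" where
  "iso_obj R x y \<longleftrightarrow> x \<in> Ob R \<and> y \<in> Ob R \<and>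
     (\<exists>f\<in>Hom R x y. \<exists>g\<in>Hom R y x. cmp R g f = idm R x \<and> cmp R f g = idm R y)"

definition isocl :: "('o, 'h, 'k) ringoid \<Rightarrow> 'o \<Rightarrow> 'o set" where
  "isocl R e = {x \<in> Ob R. iso_obj R x e}"

definition indc :: "('o, 'h, 'k) ringoid \<Rightarrow> 'o set \<Rightarrow> 'o set set" where
  "indc R S = {isocl R e | e. e \<in> S \<and> local_obj R e}"

definition rep :: "'o set \<Rightarrow> 'o" where
  "rep c = (SOME e. e \<in> c)"

text \<open>A right R-module (additive contravariant functor R -> Ab): abelian groups
  Mc x for objects x, and for f in Hom x y the map act x y f : Mc y -> Mc x.\<close>

record ('o, 'h, 'm) rmod =
  Mc :: "'o \<Rightarrow> 'm set"
  madd :: "'o \<Rightarrow> 'm \<Rightarrow> 'm \<Rightarrow> 'm"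
  mzero :: "'o \<Rightarrow> 'm"
  mneg :: "'o \<Rightarrow> 'm \<Rightarrow> 'm"
  act :: "'o \<Rightarrow> 'o \<Rightarrow> 'h \<Rightarrow> 'm \<Rightarrow> 'm"

definition is_rmod :: "('o, 'h, 'k) ringoid \<Rightarrow> ('o, 'h, 'm) rmod \<Rightarrow> bool" where
  "is_rmod R M \<longleftrightarrow>
     (\<forall>x\<in>Ob R. abgrp_on (Mc M x) (madd M x) (mzero M x) (mneg M x)) \<and>
     (\<forall>x\<in>Ob R. \<forall>y\<in>Ob R. \<forall>f\<in>Hom R x y. \<forall>m\<in>Mc M y. act M x y f m \<in> Mc M x) \<and>
     (\<forall>x\<in>Ob R. \<forall>y\<in>Ob R. \<forall>f\<in>Hom R x y. \<forall>m\<in>Mc M y. \<forall>m'\<in>Mc M y.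
        act M x y f (madd M y m m') = madd M x (act M x y f m) (act M x y f m')) \<and>
     (\<forall>x\<in>Ob R. \<forall>y\<in>Ob R. \<forall>f\<in>Hom R x y. \<forall>f'\<in>Hom R x y. \<forall>m\<in>Mc M y.
        act M x y (hadd R f f') m = madd M x (act M x y f m) (act M x y f' m)) \<and>
     (\<forall>x\<in>Ob R. \<forall>m\<in>Mc M x. act M x x (idm R x) m = m) \<and>
     (\<forall>x\<in>Ob R. \<forall>y\<in>Ob R. \<forall>z\<in>Ob R. \<forall>f\<in>Hom R x y. \<forall>g\<in>Hom R y z. \<forall>m\<in>Mc M z.
        act M x z (cmp R g f) m = act M x y f (act M y z g m))"

definition hom_rmod :: "('o, 'h, 'k) ringoid \<Rightarrow> ('o, 'h, 'm) rmod \<Rightarrow> ('o, 'h, 'n) rmod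
     \<Rightarrow> ('o \<Rightarrow> 'm \<Rightarrow> 'n) \<Rightarrow> bool" where
  "hom_rmod R M N \<phi> \<longleftrightarrow>
     (\<forall>x\<in>Ob R. \<forall>m\<in>Mc M x. \<phi> x m \<in> Mc N x) \<and>
     (\<forall>x\<in>Ob R. \<forall>m\<in>Mc M x. \<forall>m'\<in>Mc M x. \<phi> x (madd M x m m') = madd N x (\<phi> x m) (\<phi> x m')) \<and>
     (\<forall>x\<in>Ob R. \<forall>y\<in>Ob R. \<forall>f\<in>Hom R x y. \<forall>m\<in>Mc M y.
        \<phi> x (act M x y f m) = act N x y f (\<phi> y m))"

definition iso_rmod :: "('o, 'h, 'k) ringoid \<Rightarrow> ('o, 'h, 'm) rmod \<Rightarrow> ('o, 'h, 'n) rmod \<Rightarrow> bool" where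
  "iso_rmod R M N \<longleftrightarrow>
     (\<exists>\<phi>. hom_rmod R M N \<phi> \<and> (\<forall>x\<in>Ob R. bij_betw (\<phi> x) (Mc M x) (Mc N x)))"

definition submod :: "('o, 'h, 'k) ringoid \<Rightarrow> ('o, 'h, 'm) rmod \<Rightarrow> ('o \<Rightarrow> 'm set) \<Rightarrow> bool" where
  "submod R M S \<longleftrightarrow>
     (\<forall>x\<in>Ob R. S x \<subseteq> Mc M x \<and> mzero M x \<in> S x \<and>
        (\<forall>a\<in>S x. \<forall>b\<in>S x. madd M x a b \<in> S x) \<and> (\<forall>a\<in>S x. mneg M x a \<in> S x)) \<and>
     (\<forall>x\<in>Ob R. \<forall>y\<in>Ob R. \<forall>f\<in>Hom R x y. \<forall>m\<in>S y. act M x y f m \<in> S x)"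

definition is_zero_rmod :: "('o, 'h, 'k) ringoid \<Rightarrow> ('o, 'h, 'm) rmod \<Rightarrow> bool" where
  "is_zero_rmod R M \<longleftrightarrow> (\<forall>x\<in>Ob R. Mc M x = {mzero M x})"

definition coset :: "('o, 'h, 'm) rmod \<Rightarrow> ('o \<Rightarrow> 'm set) \<Rightarrow> 'o \<Rightarrow> 'm \<Rightarrow> 'm set" where
  "coset M S x m = {madd M x m s | s. s \<in> S x}"

definition quot :: "('o, 'h, 'k) ringoid \<Rightarrow> ('o, 'h, 'm) rmod \<Rightarrow> ('o \<Rightarrow> 'm set) \<Rightarrow> ('o \<Rightarrow> 'm set)
     \<Rightarrow> ('o, 'h, 'm set) rmod" where
  "quot R M T S =
     \<lparr> Mc = (\<lambda>x. coset M S x ` T x),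
       madd = (\<lambda>x A B. {madd M x a b | a b. a \<in> A \<and> b \<in> B}),
       mzero = (\<lambda>x. S x),
       mneg = (\<lambda>x A. mneg M x ` A),
       act = (\<lambda>x y f A. {madd M x (act M x y f a) s | a s. a \<in> A \<and> s \<in> S x}) \<rparr>"

definition dsum :: "'i set \<Rightarrow> ('i \<Rightarrow> ('o, 'h, 'm) rmod) \<Rightarrow> ('o, 'h, 'i \<Rightarrow> 'm) rmod" where
  "dsum I F =
     \<lparr> Mc = (\<lambda>x. {v. (\<forall>i\<in>I. v i \<in> Mc (F i) x) \<and> (\<forall>i. i \<notin> I \<longrightarrow> v i = undefined) \<and>
                      finite {i \<in> I. v i \<noteq> mzero (F i) x}}),
       madd = (\<lambda>x v w i. if i \<in> I then madd (F i) x (v i) (w i) else undefined),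
       mzero = (\<lambda>x i. if i \<in> I then mzero (F i) x else undefined),
       mneg = (\<lambda>x v i. if i \<in> I then mneg (F i) x (v i) else undefined),
       act = (\<lambda>x y f v i. if i \<in> I then act (F i) x y f (v i) else undefined) \<rparr>"

definition Yo :: "('o, 'h, 'k) ringoid \<Rightarrow> 'o \<Rightarrow> ('o, 'h, 'h) rmod" where
  "Yo R e = \<lparr> Mc = (\<lambda>x. Hom R x e), madd = (\<lambda>x. hadd R), mzero = (\<lambda>x. hzero R x e),
              mneg = (\<lambda>x. hneg R), act = (\<lambda>x y f g. cmp R g f) \<rparr>"

text \<open>Trace of P in M: the sum of the images of all morphisms P -> M
  (the smallest submodule containing all these images).\<close>

definition trace :: "('o, 'h, 'k) ringoid \<Rightarrow> ('o, 'h, 'p) rmod \<Rightarrow> ('o, 'h, 'm) rmod \<Rightarrow> 'o \<Rightarrow> 'm set" where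
  "trace R P M x = \<Inter> {S x | S. submod R M S \<and>
      (\<forall>\<phi>. hom_rmod R P M \<phi> \<longrightarrow> (\<forall>y\<in>Ob R. \<phi> y ` Mc P y \<subseteq> S y))}"

definition in_addcls :: "('o, 'h, 'k) ringoid \<Rightarrow> ('o, 'h, 'a) rmod set \<Rightarrow> ('o, 'h, 'b) rmod \<Rightarrow> bool" where
  "in_addcls R X N \<longleftrightarrow> (\<exists>Ls. set Ls \<subseteq> X \<and> iso_rmod R N (dsum {..<length Ls} (nth Ls)))"

definition in_Ff :: "('o, 'h, 'k) ringoid \<Rightarrow> ('o, 'h, 'a) rmod set \<Rightarrow> ('o, 'h, 'm) rmod \<Rightarrow> bool" where
  "in_Ff R X M \<longleftrightarrow> (\<exists>(n::nat) Ch. (\<forall>k\<le>n. submod R M (Ch k)) \<and>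
     (\<forall>x\<in>Ob R. Ch 0 x = {mzero M x} \<and> Ch n x = Mc M x) \<and>
     (\<forall>k<n. (\<forall>x\<in>Ob R. Ch k x \<subseteq> Ch (Suc k) x) \<and>
            in_addcls R X (quot R M (Ch (Suc k)) (Ch k))))"

text \<open>The ordinal alpha is represented by a well-order r; its elements
  (the i < alpha) are Field r, and i \<le> j means (i, j) \<in> r.\<close>

definition sect :: "('o, 'h, 'k) ringoid \<Rightarrow> 'i rel \<Rightarrow> ('i \<Rightarrow> 'o set) \<Rightarrow> 'i \<Rightarrow> 'o set set" where
  "sect R r B i = indc R (B i) - (\<Union>j\<in>{j. (j, i) \<in> r \<and> j \<noteq> i}. indc R (B j))"

definition exh_adm :: "('o, 'h, 'k) ringoid \<Rightarrow> 'i rel \<Rightarrow> ('i \<Rightarrow> 'o set) \<Rightarrow> bool" where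
  "exh_adm R r B \<longleftrightarrow> Well_order r \<and>
     (\<forall>i\<in>Field r. B i \<subseteq> Ob R \<and> add_cl R (B i) = B i) \<and>
     (\<forall>i j. (i, j) \<in> r \<longrightarrow> B i \<subseteq> B j) \<and>
     (\<Union>i\<in>Field r. B i) = Ob R \<and>
     (\<forall>i\<in>Field r. sect R r B i \<noteq> {})"

definition Pbar :: "('o, 'h, 'k) ringoid \<Rightarrow> 'i rel \<Rightarrow> ('i \<Rightarrow> 'o set) \<Rightarrow> 'i
     \<Rightarrow> ('o, 'h, 'o set \<Rightarrow> 'h) rmod" where
  "Pbar R r B j = dsum (sect R r B j) (\<lambda>c. Yo R (rep c))"

definition tau :: "('o, 'h, 'k) ringoid \<Rightarrow> 'i rel \<Rightarrow> ('i \<Rightarrow> 'o set) \<Rightarrow> 'i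
     \<Rightarrow> ('o, 'h, 'm) rmod \<Rightarrow> 'o \<Rightarrow> 'm set" where
  "tau R r B i M = trace R (dsum {j. (j, i) \<in> r} (Pbar R r B)) M"

definition taubar :: "('o, 'h, 'k) ringoid \<Rightarrow> 'i rel \<Rightarrow> ('i \<Rightarrow> 'o set) \<Rightarrow> 'i
     \<Rightarrow> ('o, 'h, 'm) rmod \<Rightarrow> 'o \<Rightarrow> 'm set" where
  "taubar R r B i M = trace R (dsum {j. (j, i) \<in> r \<and> j \<noteq> i} (Pbar R r B)) M"

definition Delta_e :: "('o, 'h, 'k) ringoid \<Rightarrow> 'i rel \<Rightarrow> ('i \<Rightarrow> 'o set) \<Rightarrow> 'i \<Rightarrow> 'o set
     \<Rightarrow> ('o, 'h, 'h set) rmod" where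
  "Delta_e R r B i c = quot R (Yo R (rep c)) (Mc (Yo R (rep c))) (taubar R r B i (Yo R (rep c)))"

definition Delta :: "('o, 'h, 'k) ringoid \<Rightarrow> 'i rel \<Rightarrow> ('i \<Rightarrow> 'o set) \<Rightarrow> 'i
     \<Rightarrow> ('o, 'h, 'h set) rmod set" where
  "Delta R r B i = Delta_e R r B i ` sect R r B i"

definition Delta_all :: "('o, 'h, 'k) ringoid \<Rightarrow> 'i rel \<Rightarrow> ('i \<Rightarrow> 'o set) \<Rightarrow> ('o, 'h, 'h set) rmod set" where
  "Delta_all R r B = (\<Union>i\<in>Field r. Delta R r B i)"

end

theory Submission
  imports Defs
begin

text \<open>
  For a set X of objects and a submodule S of M let gen X S be the submodule generated by the
  elements of S at objects of X. By the Yoneda lemma the traces of the theorem are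
  \<open>gen X M\<close>, where X consists of the chosen representatives of the sections up to (or strictly
  below) i. A module lies in \<open>\<Delta>(i)\<^sup>\<oplus>\<close> as a quotient T/S iff T is
  generated over S by elements \<open>m\<^sub>k \<in> T(e\<^sub>k)\<close> whose only
  relations \<open>\<Sum> m\<^sub>k f\<^sub>k \<in> S\<close> are those with every \<open>f\<^sub>k\<close> in the trace of
  \<open>Y(e\<^sub>k)\<close>.

  For (a) implies (b), refine the filtration to steps \<open>S = A + \<langle>p\<rangle>\<close> with
  \<open>S/A \<cong> \<Delta>\<^sub>e(j)\<close>. Since \<open>\<Delta>\<^sub>e(j)\<close> vanishes at all
  generators below j, passing from A to S leaves the traces below j unchanged, and adjoins p to all
  others; and \<open>\<langle>p\<rangle> \<inter> A\<close> already lies in the trace of A strictly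
  below j. Hence only the j-th layer changes, gaining one copy of \<open>\<Delta>\<^sub>e(j)\<close>.

  For (b) implies (a), well-founded induction shows that the trace at i is determined by the traces
  at the finitely many jumps up to i, so that the traces at the jumps form a finite filtration.
\<close>

section \<open>Modules, quotients and direct sums\<close>

text \<open>Traces of projectives are compatible with quotients but not with submodules: A may meet
  the trace of S in more than the trace of A. Hence the layers of S cannot in general be read off
  from those of A and S/A. What rescues the argument is the shape of the annihilator of p modulo A.
  It is generated by morphisms z -> e with z strictly below j, and at such z the modules A and S
  coincide. Each of these morphisms therefore carries p into A(z), which consists of generators of
  the trace of A strictly below j. So every relation of p modulo A is already a relation modulo that
  small trace, and modulo every larger one.

  Describing layers by elements and relations keeps everything inside M. When numerator and
  denominator both grow by p, the very same elements remain a basis, and no map between different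
  quotients has to be built.

  In the converse direction the obstacle is the limit indices. Finiteness of the set of jumps
  provides a greatest jump below any index, unless there is none, and its trace is the whole trace
  strictly below that index.\<close>

locale abgrp =
  fixes A :: "'a set" and add z neg
  assumes abgrp: "abgrp_on A add z neg"
begin

lemma zero_closed [simp]: "z \<in> A"
  and add_closed [simp]: "a \<in> A \<Longrightarrow> b \<in> A \<Longrightarrow> add a b \<in> A"
  and neg_closed [simp]: "a \<in> A \<Longrightarrow> neg a \<in> A"
  and assoc: "a \<in> A \<Longrightarrow> b \<in> A \<Longrightarrow> c \<in> A \<Longrightarrow> add (add a b) c = add a (add b c)"
  and comm: "a \<in> A \<Longrightarrow> b \<in> A \<Longrightarrow> add a b = add b a"
  and add_0 [simp]: "a \<in> A \<Longrightarrow> add z a = a"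
  and add_neg [simp]: "a \<in> A \<Longrightarrow> add (neg a) a = z"
  using abgrp unfolding abgrp_on_def by blast+

lemma lcomm: "a \<in> A \<Longrightarrow> b \<in> A \<Longrightarrow> c \<in> A \<Longrightarrow> add a (add b c) = add b (add a c)"
  by (metis assoc comm)

lemma add_0_right [simp]: "a \<in> A \<Longrightarrow> add a z = a"
  using comm[of a z] by simp

lemma add_neg_right [simp]: "a \<in> A \<Longrightarrow> add a (neg a) = z"
  using comm[of a "neg a"] by simp

lemma neg_add_cancel [simp]: "a \<in> A \<Longrightarrow> b \<in> A \<Longrightarrow> add (neg a) (add a b) = b"
  using assoc[of "neg a" a b] by simp

lemma add_neg_cancel [simp]: "a \<in> A \<Longrightarrow> b \<in> A \<Longrightarrow> add a (add (neg a) b) = b"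
  using assoc[of a "neg a" b] by simp

lemma cancel: "a \<in> A \<Longrightarrow> b \<in> A \<Longrightarrow> c \<in> A \<Longrightarrow> add a b = add a c \<longleftrightarrow> b = c"
  by (metis neg_add_cancel)

lemma neg_unique: "a \<in> A \<Longrightarrow> b \<in> A \<Longrightarrow> add a b = z \<Longrightarrow> b = neg a"
  by (metis add_neg_right cancel neg_closed)

lemma neg_zero [simp]: "neg z = z"
  using neg_unique[of z z] by simp

lemma neg_neg [simp]: "a \<in> A \<Longrightarrow> neg (neg a) = a"
  using neg_unique[of "neg a" a] by simp

lemma neg_add: "a \<in> A \<Longrightarrow> b \<in> A \<Longrightarrow> neg (add a b) = add (neg a) (neg b)"
  by (rule neg_unique[symmetric]) (simp_all add: assoc lcomm[of b])

lemma idem_zero: "a \<in> A \<Longrightarrow> add a a = a \<Longrightarrow> a = z"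
  using cancel[of a a z] by simp

lemma add_diff: "a \<in> A \<Longrightarrow> b \<in> A \<Longrightarrow> add b (add a (neg b)) = a"
  by (simp add: lcomm[of b])

end

section \<open>Modules over a ringoid and representable modules\<close>

locale rmodule =
  fixes R :: "('o, 'h, 'k::comm_ring_1) ringoid" and M :: "('o, 'h, 'm) rmod"
  assumes ringoid: "K_ringoid R" and rmod: "is_rmod R M"
begin

lemma grp: "x \<in> Ob R \<Longrightarrow> abgrp (Mc M x) (madd M x) (mzero M x) (mneg M x)"
  using rmod by (simp add: is_rmod_def abgrp_def)

lemmas zero_closed [simp] = abgrp.zero_closed[OF grp]
  and add_closed [simp] = abgrp.add_closed[OF grp]
  and neg_closed [simp] = abgrp.neg_closed[OF grp]
  and assoc = abgrp.assoc[OF grp]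
  and comm = abgrp.comm[OF grp]
  and lcomm = abgrp.lcomm[OF grp]
  and add_0 [simp] = abgrp.add_0[OF grp]
  and add_neg [simp] = abgrp.add_neg[OF grp]
  and add_0_right [simp] = abgrp.add_0_right[OF grp]
  and add_neg_right [simp] = abgrp.add_neg_right[OF grp]
  and neg_add_cancel [simp] = abgrp.neg_add_cancel[OF grp]
  and add_neg_cancel [simp] = abgrp.add_neg_cancel[OF grp]
  and cancel = abgrp.cancel[OF grp]
  and neg_unique = abgrp.neg_unique[OF grp]
  and neg_zero [simp] = abgrp.neg_zero[OF grp]
  and neg_neg [simp] = abgrp.neg_neg[OF grp]
  and neg_add = abgrp.neg_add[OF grp]
  and idem_zero = abgrp.idem_zero[OF grp]
  and add_diff = abgrp.add_diff[OF grp]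

lemma act_closed [simp]:
    "x \<in> Ob R \<Longrightarrow> y \<in> Ob R \<Longrightarrow> f \<in> Hom R x y \<Longrightarrow> m \<in> Mc M y \<Longrightarrow> act M x y f m \<in> Mc M x"
  and act_add: "x \<in> Ob R \<Longrightarrow> y \<in> Ob R \<Longrightarrow> f \<in> Hom R x y \<Longrightarrow> m \<in> Mc M y \<Longrightarrow> m' \<in> Mc M y \<Longrightarrow>
      act M x y f (madd M y m m') = madd M x (act M x y f m) (act M x y f m')"
  and act_hadd: "x \<in> Ob R \<Longrightarrow> y \<in> Ob R \<Longrightarrow> f \<in> Hom R x y \<Longrightarrow> f' \<in> Hom R x y \<Longrightarrow> m \<in> Mc M y \<Longrightarrow>
      act M x y (hadd R f f') m = madd M x (act M x y f m) (act M x y f' m)"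
  and act_id [simp]: "x \<in> Ob R \<Longrightarrow> n \<in> Mc M x \<Longrightarrow> act M x x (idm R x) n = n"
  and act_cmp: "x \<in> Ob R \<Longrightarrow> y \<in> Ob R \<Longrightarrow> u \<in> Ob R \<Longrightarrow> f \<in> Hom R x y \<Longrightarrow> g \<in> Hom R y u \<Longrightarrow>
      p \<in> Mc M u \<Longrightarrow> act M x u (cmp R g f) p = act M x y f (act M y u g p)"
  using rmod by (simp_all add: is_rmod_def)

lemma act_zero [simp]:
  "x \<in> Ob R \<Longrightarrow> y \<in> Ob R \<Longrightarrow> f \<in> Hom R x y \<Longrightarrow> act M x y f (mzero M y) = mzero M x"
  by (rule idem_zero) (auto simp flip: act_add)

end

lemma Yo_sel [simp]: "Mc (Yo R e) = (\<lambda>x. Hom R x e)" "madd (Yo R e) = (\<lambda>x. hadd R)"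
  "mzero (Yo R e) = (\<lambda>x. hzero R x e)" "mneg (Yo R e) = (\<lambda>x. hneg R)"
  "act (Yo R e) = (\<lambda>x y f g. cmp R g f)"
  by (simp_all add: Yo_def)

lemma Yo_rmodule: assumes "K_ringoid R" "e \<in> Ob R" shows "rmodule R (Yo R e)"
proof
  show "K_ringoid R" by fact
  show "is_rmod R (Yo R e)"
    using assms unfolding K_ringoid_def is_rmod_def Kmod_on_def by simp
qed

lemma id_closed: "K_ringoid R \<Longrightarrow> x \<in> Ob R \<Longrightarrow> idm R x \<in> Hom R x x"
  by (simp add: K_ringoid_def)

lemma cmp_closed: "K_ringoid R \<Longrightarrow> x \<in> Ob R \<Longrightarrow> y \<in> Ob R \<Longrightarrow> w \<in> Ob R \<Longrightarrow> f \<in> Hom R x y \<Longrightarrow>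
   g \<in> Hom R y w \<Longrightarrow> cmp R g f \<in> Hom R x w"
  by (simp add: K_ringoid_def)

lemma cmp_id: "K_ringoid R \<Longrightarrow> x \<in> Ob R \<Longrightarrow> y \<in> Ob R \<Longrightarrow> f \<in> Hom R x y \<Longrightarrow> cmp R (idm R y) f = f"
  by (simp add: K_ringoid_def)

lemma hom_rmodD:
  assumes "hom_rmod R M N \<phi>"
  shows "\<And>x m. x \<in> Ob R \<Longrightarrow> m \<in> Mc M x \<Longrightarrow> \<phi> x m \<in> Mc N x"
    "\<And>x m m'. x \<in> Ob R \<Longrightarrow> m \<in> Mc M x \<Longrightarrow> m' \<in> Mc M x \<Longrightarrow>
        \<phi> x (madd M x m m') = madd N x (\<phi> x m) (\<phi> x m')"
    "\<And>x y f m. x \<in> Ob R \<Longrightarrow> y \<in> Ob R \<Longrightarrow> f \<in> Hom R x y \<Longrightarrow> m \<in> Mc M y \<Longrightarrow>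
        \<phi> x (act M x y f m) = act N x y f (\<phi> y m)"
  using assms unfolding hom_rmod_def by blast+

text \<open>\<open>hom_rmod\<close> demands additivity only. The image of zero is idempotent under
  addition, and in a group this forces it to be zero.\<close>

lemma hom_zero:
  assumes "rmodule R M" "rmodule R N" "hom_rmod R M N \<phi>" "x \<in> Ob R"
  shows "\<phi> x (mzero M x) = mzero N x"
proof -
  interpret M: rmodule R M by fact
  interpret N: rmodule R N by fact
  show ?thesis
    using hom_rmodD(1)[OF assms(3,4)] assms(4)
    by (intro N.idem_zero) (auto simp flip: hom_rmodD(2)[OF assms(3,4)])
qed

lemma submodD:
  assumes "submod R M S" "x \<in> Ob R"
  shows "a \<in> S x \<Longrightarrow> a \<in> Mc M x" "mzero M x \<in> S x"
    "a \<in> S x \<Longrightarrow> b \<in> S x \<Longrightarrow> madd M x a b \<in> S x" "a \<in> S x \<Longrightarrow> mneg M x a \<in> S x"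
    "y \<in> Ob R \<Longrightarrow> f \<in> Hom R x y \<Longrightarrow> m \<in> S y \<Longrightarrow> act M x y f m \<in> S x"
  using assms unfolding submod_def by blast+

context rmodule
begin

text \<open>Hom-sets are the carriers of representable modules, so their closure properties are
  those of \<open>Yo R y\<close>.\<close>

lemma hadd_closed [simp]:
    "x \<in> Ob R \<Longrightarrow> y \<in> Ob R \<Longrightarrow> f \<in> Hom R x y \<Longrightarrow> g \<in> Hom R x y \<Longrightarrow> hadd R f g \<in> Hom R x y"
  and hzero_closed [simp]: "x \<in> Ob R \<Longrightarrow> y \<in> Ob R \<Longrightarrow> hzero R x y \<in> Hom R x y"
  and hneg_closed [simp]: "x \<in> Ob R \<Longrightarrow> y \<in> Ob R \<Longrightarrow> f \<in> Hom R x y \<Longrightarrow> hneg R f \<in> Hom R x y"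
  using Yo_rmodule[OF ringoid, of y, THEN rmodule.add_closed, of x f g]
    Yo_rmodule[OF ringoid, of y, THEN rmodule.zero_closed, of x]
    Yo_rmodule[OF ringoid, of y, THEN rmodule.neg_closed, of x f]
  by simp_all

lemmas id_closed [simp] = id_closed[OF ringoid]
  and cmp_closed [simp] = cmp_closed[OF ringoid]
  and cmp_id [simp] = cmp_id[OF ringoid]

lemma act_hzero [simp]:
  "x \<in> Ob R \<Longrightarrow> y \<in> Ob R \<Longrightarrow> m \<in> Mc M y \<Longrightarrow> act M x y (hzero R x y) m = mzero M x"
  using Yo_rmodule[OF ringoid, of y, THEN rmodule.add_0, of x "hzero R x y"]
  by (intro idem_zero) (auto simp flip: act_hadd)

lemma act_hneg: "x \<in> Ob R \<Longrightarrow> y \<in> Ob R \<Longrightarrow> f \<in> Hom R x y \<Longrightarrow> m \<in> Mc M y \<Longrightarrow>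
    act M x y (hneg R f) m = mneg M x (act M x y f m)"
  using Yo_rmodule[OF ringoid, of y, THEN rmodule.add_neg_right, of x f]
  by (intro neg_unique) (auto simp flip: act_hadd)

section \<open>Submodules, cosets and quotient modules\<close>

lemma submod_self: "submod R M (Mc M)"
  by (simp add: submod_def)

lemma submod_zero: "submod R M (\<lambda>x. {mzero M x})"
  by (simp add: submod_def)

lemma submod_add_cancel:
  assumes "submod R M S" "x \<in> Ob R" "a \<in> Mc M x" "b \<in> S x"
  shows "madd M x a b \<in> S x \<longleftrightarrow> a \<in> S x" "madd M x b a \<in> S x \<longleftrightarrow> a \<in> S x"
proof -
  have b: "b \<in> Mc M x" using assms submodD by metis
  show 2: "madd M x b a \<in> S x \<longleftrightarrow> a \<in> S x"
    using submodD[OF assms(1,2)] assms b by (metis neg_add_cancel)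
  show "madd M x a b \<in> S x \<longleftrightarrow> a \<in> S x"
    using 2 comm b assms by simp
qed

lemma diff_mem_commute:
  assumes "submod R M S" "x \<in> Ob R" "a \<in> Mc M x" "b \<in> Mc M x" "madd M x a (mneg M x b) \<in> S x"
  shows "madd M x b (mneg M x a) \<in> S x"
  using submodD(4)[OF assms(1,2) assms(5)] assms by (simp add: neg_add comm)

lemma coset_self:
  assumes "submod R M S" "x \<in> Ob R" "t \<in> Mc M x"
  shows "t \<in> coset M S x t"
  using assms submodD(2)[OF assms(1,2)] add_0_right[OF assms(2,3)]
  unfolding coset_def by force

lemma mem_coset_iff:
  assumes "submod R M S" "x \<in> Ob R" "t \<in> Mc M x" "t' \<in> Mc M x"
  shows "t' \<in> coset M S x t \<longleftrightarrow> madd M x t' (mneg M x t) \<in> S x"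
proof
  assume "t' \<in> coset M S x t"
  then obtain s where s: "s \<in> S x" "t' = madd M x t s" by (auto simp: coset_def)
  moreover have "s \<in> Mc M x" using s assms submodD by metis
  ultimately show "madd M x t' (mneg M x t) \<in> S x"
    using assms by (metis comm add_diff assoc neg_closed add_neg_right add_0_right)
next
  assume "madd M x t' (mneg M x t) \<in> S x"
  then show "t' \<in> coset M S x t"
    unfolding coset_def using assms add_diff[of x t' t] by force
qed

lemma coset_eq_iff:
  assumes "submod R M S" "x \<in> Ob R" "t \<in> Mc M x" "t' \<in> Mc M x"
  shows "coset M S x t = coset M S x t' \<longleftrightarrow> madd M x t (mneg M x t') \<in> S x"
proof
  assume "coset M S x t = coset M S x t'"
  then show "madd M x t (mneg M x t') \<in> S x"
    using coset_self[OF assms(1-3)] mem_coset_iff[OF assms(1,2,4,3)] by simp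
next
  have sub: "coset M S x a \<subseteq> coset M S x b"
    if ab: "a \<in> Mc M x" "b \<in> Mc M x" "madd M x a (mneg M x b) \<in> S x" for a b
  proof
    fix u assume "u \<in> coset M S x a"
    then obtain s where s: "s \<in> S x" "u = madd M x a s" by (auto simp: coset_def)
    have [simp]: "s \<in> Mc M x" using s assms submodD by metis
    have "u = madd M x b (madd M x (madd M x a (mneg M x b)) s)"
      unfolding s(2) using ab assms(2)
      by (simp add: assoc lcomm[of x b])
    then show "u \<in> coset M S x b"
      using submodD(3)[OF assms(1,2) ab(3) s(1)] by (auto simp: coset_def)
  qed
  assume "madd M x t (mneg M x t') \<in> S x"
  then show "coset M S x t = coset M S x t'"
    using sub[of t t'] sub[of t' t] diff_mem_commute[OF assms] assms by blast
qed

lemma coset_zero: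
  assumes "submod R M S" "x \<in> Ob R"
  shows "coset M S x (mzero M x) = S x"
proof -
  have "madd M x (mzero M x) s = s" if "s \<in> S x" for s
    using that submodD(1)[OF assms] assms(2) by simp
  then show ?thesis unfolding coset_def by force
qed

lemma coset_eq_zero_iff:
  assumes "submod R M S" "x \<in> Ob R" "t \<in> Mc M x"
  shows "coset M S x t = S x \<longleftrightarrow> t \<in> S x"
  using coset_eq_iff[OF assms, of "mzero M x"] coset_zero[OF assms(1,2)] assms by simp

text \<open>The operations of \<open>quot\<close> work elementwise on sets and choose no
  representatives. This and the next two lemmas identify the resulting sets as cosets, which is
  where well-definedness is settled.\<close>

lemma coset_add:
  assumes "submod R M S" "x \<in> Ob R" "t \<in> Mc M x" "t' \<in> Mc M x"
  shows "{madd M x a b | a b. a \<in> coset M S x t \<and> b \<in> coset M S x t'} = coset M S x (madd M x t t')"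
    (is "?L = ?R")
proof
  note [simp] = assms(2-4)
  have S: "s \<in> S x \<Longrightarrow> s \<in> Mc M x" for s using assms submodD by metis
  show "?L \<subseteq> ?R"
  proof
    fix u assume "u \<in> ?L"
    then obtain s s' where s: "s \<in> S x" "s' \<in> S x" "u = madd M x (madd M x t s) (madd M x t' s')"
      by (auto simp: coset_def)
    then have "u = madd M x (madd M x t t') (madd M x s s')"
      using S by (simp add: assoc lcomm[of x s])
    then show "u \<in> ?R" using s submodD(3)[OF assms(1,2)] by (auto simp: coset_def)
  qed
  show "?R \<subseteq> ?L"
  proof
    fix u assume "u \<in> ?R"
    then obtain s where s: "s \<in> S x" "u = madd M x (madd M x t t') s" by (auto simp: coset_def)
    then have "u = madd M x t (madd M x t' s)" using S by (simp add: assoc)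
    moreover have "madd M x t' s \<in> coset M S x t'" using s by (auto simp: coset_def)
    ultimately show "u \<in> ?L" using coset_self[OF assms(1-3)] by auto
  qed
qed

lemma coset_neg:
  assumes "submod R M S" "x \<in> Ob R" "t \<in> Mc M x"
  shows "mneg M x ` coset M S x t = coset M S x (mneg M x t)" (is "?L = ?R")
proof
  note [simp] = assms(2-3)
  have S: "s \<in> S x \<Longrightarrow> s \<in> Mc M x" for s using assms submodD by metis
  show "?L \<subseteq> ?R"
    using S submodD(4)[OF assms(1,2)] by (force simp: coset_def neg_add)
  show "?R \<subseteq> ?L"
  proof
    fix u assume "u \<in> ?R"
    then obtain s where s: "s \<in> S x" "u = madd M x (mneg M x t) s" by (auto simp: coset_def)
    then have "u = mneg M x (madd M x t (mneg M x s))" using S by (simp add: neg_add)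
    moreover have "madd M x t (mneg M x s) \<in> coset M S x t"
      using s submodD(4)[OF assms(1,2)] by (auto simp: coset_def)
    ultimately show "u \<in> ?L" by blast
  qed
qed

text \<open>The image of a coset of \<open>S y\<close> under f is in general only part of a coset of
  \<open>S x\<close>; the summand s fills it up.\<close>

lemma coset_act:
  assumes "submod R M S" "x \<in> Ob R" "y \<in> Ob R" "f \<in> Hom R x y" "t \<in> Mc M y"
  shows "{madd M x (act M x y f a) s | a s. a \<in> coset M S y t \<and> s \<in> S x}
       = coset M S x (act M x y f t)" (is "?L = ?R")
proof
  note [simp] = assms(2-5)
  have S: "s \<in> S x \<Longrightarrow> s \<in> Mc M x" "s \<in> S y \<Longrightarrow> s \<in> Mc M y" for s using assms submodD by metis+
  show "?L \<subseteq> ?R"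
  proof
    fix u assume "u \<in> ?L"
    then obtain s s' where s: "s \<in> S x" "s' \<in> S y" "u = madd M x (act M x y f (madd M y t s')) s"
      by (auto simp: coset_def)
    then have "u = madd M x (act M x y f t) (madd M x (act M x y f s') s)"
      using S by (simp add: assoc act_add)
    moreover have "madd M x (act M x y f s') s \<in> S x"
      using submodD(3,5)[OF assms(1,2)] s by simp
    ultimately show "u \<in> ?R" using s by (auto simp: coset_def)
  qed
  show "?R \<subseteq> ?L"
    using coset_self[OF assms(1,3,5)] by (auto simp: coset_def[of M S x])
qed

lemma quot_sel:
  assumes "submod R M S" "x \<in> Ob R" "t \<in> Mc M x"
  shows "t' \<in> Mc M x \<Longrightarrow>
       madd (quot R M T S) x (coset M S x t) (coset M S x t') = coset M S x (madd M x t t')"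
    "mneg (quot R M T S) x (coset M S x t) = coset M S x (mneg M x t)"
    "w \<in> Ob R \<Longrightarrow> f \<in> Hom R w x \<Longrightarrow>
       act (quot R M T S) w x f (coset M S x t) = coset M S w (act M w x f t)"
  using coset_add[OF assms] coset_neg[OF assms] coset_act[OF assms(1), of w x f t] assms
  by (simp_all add: quot_def)

lemma Mc_quot: "Mc (quot R M T S) x = coset M S x ` T x"
  by (simp add: quot_def)

lemma mzero_quot: "mzero (quot R M T S) x = S x"
  by (simp add: quot_def)

lemma quot_rmodule:
  assumes "submod R M S" "submod R M T"
  shows "rmodule R (quot R M T S)"
proof
  have T [simp]: "t \<in> T x \<Longrightarrow> t \<in> Mc M x" if "x \<in> Ob R" for x t using assms that submodD by metis
  note [simp] = quot_sel[OF assms(1)] Mc_quot mzero_quot submodD[OF assms(2)]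
  \<comment> \<open>The zero of the quotient is the bare set \<open>S x\<close>; the rules for
    cosets apply once it is written as the coset of zero.\<close>
  have z: "madd (quot R M T S) x (S x) (coset M S x t) = coset M S x t" if "x \<in> Ob R" "t \<in> T x" for x t
    using that by (subst coset_zero[OF assms(1), symmetric]) auto
  have c: "coset M S x (madd M x a b) = coset M S x (madd M x b a)"
    if "x \<in> Ob R" "a \<in> T x" "b \<in> T x" for x a b
    using that by (simp add: comm)
  show "is_rmod R (quot R M T S)"
    unfolding is_rmod_def abgrp_on_def
    using coset_zero[OF assms(1)] submodD(2)[OF assms(2)]
    by (auto simp: assoc z c act_add act_hadd act_cmp intro!: image_eqI
        intro: sym[OF coset_zero[OF assms(1)]])
qed (rule ringoid)

end

section \<open>Direct sums and their coordinate embeddings\<close>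

lemma dsum_sel:
  "Mc (dsum I F) x = {v. (\<forall>i\<in>I. v i \<in> Mc (F i) x) \<and> (\<forall>i. i \<notin> I \<longrightarrow> v i = undefined) \<and>
     finite {i \<in> I. v i \<noteq> mzero (F i) x}}"
  "madd (dsum I F) x v w = (\<lambda>i. if i \<in> I then madd (F i) x (v i) (w i) else undefined)"
  "mzero (dsum I F) x = (\<lambda>i. if i \<in> I then mzero (F i) x else undefined)"
  "mneg (dsum I F) x v = (\<lambda>i. if i \<in> I then mneg (F i) x (v i) else undefined)"
  "act (dsum I F) x y f v = (\<lambda>i. if i \<in> I then act (F i) x y f (v i) else undefined)"
  by (simp_all add: dsum_def)

text \<open>Elements and operations take the fixed value \<open>undefined\<close> off I, so equality
  of records holds and not merely an isomorphism.\<close>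

lemma dsum_cong:
  assumes "\<And>i. i \<in> I \<Longrightarrow> F i = G i"
  shows "dsum I F = dsum I G"
proof -
  have "{i \<in> I. v i \<noteq> mzero (F i) x} = {i \<in> I. v i \<noteq> mzero (G i) x}" for v x
    using assms by auto
  then show ?thesis
    using assms by (simp add: dsum_def cong: if_cong)
qed

lemma dsum_rmodule:
  assumes "K_ringoid R" and F: "\<And>i. i \<in> I \<Longrightarrow> rmodule R (F i)"
  shows "rmodule R (dsum I F)"
proof
  note r [simp] = rmodule.zero_closed[OF F] rmodule.add_closed[OF F] rmodule.neg_closed[OF F]
    rmodule.act_closed[OF F] rmodule.add_0[OF F] rmodule.add_neg[OF F] rmodule.act_zero[OF F]
    rmodule.neg_zero[OF F] rmodule.act_id[OF F]
  have "finite {i \<in> I. madd (F i) x (v i) (w i) \<noteq> mzero (F i) x}"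
    if "x \<in> Ob R" "finite {i \<in> I. v i \<noteq> mzero (F i) x}" "finite {i \<in> I. w i \<noteq> mzero (F i) x}" for x v w
    by (rule finite_subset[OF _ finite_UnI[OF that(2,3)]]) (use that(1) in auto)
  moreover have "finite {i \<in> I. mneg (F i) x (v i) \<noteq> mzero (F i) x}"
    if "x \<in> Ob R" "finite {i \<in> I. v i \<noteq> mzero (F i) x}" for x v
    by (rule finite_subset[OF _ that(2)]) (use that(1) in auto)
  moreover have "finite {i \<in> I. act (F i) x y f (v i) \<noteq> mzero (F i) x}"
    if "x \<in> Ob R" "y \<in> Ob R" "f \<in> Hom R x y" "finite {i \<in> I. v i \<noteq> mzero (F i) y}" for x y f v
    by (rule finite_subset[OF _ that(4)]) (use that in auto)
  moreover have "{i. (i \<in> I \<longrightarrow> P i) \<and> i \<in> I} = {i \<in> I. P i}" for P by blast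
  ultimately show "is_rmod R (dsum I F)"
    unfolding is_rmod_def abgrp_on_def
    by (auto simp: dsum_sel fun_eq_iff rmodule.assoc[OF F] intro: rmodule.comm[OF F]
        rmodule.act_add[OF F] rmodule.act_hadd[OF F] rmodule.act_cmp[OF F])
qed fact

text \<open>The embedding of the i-th summand, with the value \<open>undefined\<close> off I that
  carriers of \<open>dsum\<close> require.\<close>

definition dsingle :: "'i set \<Rightarrow> ('i \<Rightarrow> ('o, 'h, 'm) rmod) \<Rightarrow> 'i \<Rightarrow> 'o \<Rightarrow> 'm \<Rightarrow> 'i \<Rightarrow> 'm" where
  "dsingle I F i x a = (\<lambda>k. if k \<in> I then if k = i then a else mzero (F k) x else undefined)"

lemma dsingle_closed:
  assumes "\<And>i. i \<in> I \<Longrightarrow> rmodule R (F i)" "x \<in> Ob R" "i \<in> I" "a \<in> Mc (F i) x"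
  shows "dsingle I F i x a \<in> Mc (dsum I F) x"
  unfolding dsum_sel
  using assms rmodule.zero_closed[OF assms(1)]
  by (auto simp: dsingle_def intro!: finite_subset[of _ "{i}"] split: if_splits)

lemma dsingle_add:
  assumes "\<And>i. i \<in> I \<Longrightarrow> rmodule R (F i)" "x \<in> Ob R" "i \<in> I"
  shows "madd (dsum I F) x (dsingle I F i x a) (dsingle I F i x b) = dsingle I F i x (madd (F i) x a b)"
  using assms rmodule.zero_closed[OF assms(1)] rmodule.add_0[OF assms(1)]
  by (auto simp: dsum_sel dsingle_def)

lemma dsingle_act:
  assumes "\<And>i. i \<in> I \<Longrightarrow> rmodule R (F i)" "x \<in> Ob R" "y \<in> Ob R" "f \<in> Hom R x y" "i \<in> I"
  shows "act (dsum I F) x y f (dsingle I F i y a) = dsingle I F i x (act (F i) x y f a)"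
  using assms rmodule.act_zero[OF assms(1)] by (auto simp: dsum_sel dsingle_def)

text \<open>Finite support makes every element a finite sum of coordinate vectors, even when I is
  infinite. The induction runs over a finite set J containing the support, because the support
  itself need not shrink in a prescribed order.\<close>

lemma dsum_induct:
  assumes F: "\<And>i. i \<in> I \<Longrightarrow> rmodule R (F i)" and x: "x \<in> Ob R" and v: "v \<in> Mc (dsum I F) x"
    and zero: "P (mzero (dsum I F) x)"
    and add: "\<And>v w. v \<in> Mc (dsum I F) x \<Longrightarrow> w \<in> Mc (dsum I F) x \<Longrightarrow> P v \<Longrightarrow> P w \<Longrightarrow>
         P (madd (dsum I F) x v w)"
    and single: "\<And>i a. i \<in> I \<Longrightarrow> a \<in> Mc (F i) x \<Longrightarrow> P (dsingle I F i x a)"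
  shows "P v"
proof -
  have "\<forall>v\<in>Mc (dsum I F) x. {i \<in> I. v i \<noteq> mzero (F i) x} \<subseteq> J \<longrightarrow> P v"
    if "finite J" "J \<subseteq> I" for J
    using that
  proof (induction J rule: finite_induct)
    case empty
    have "v = mzero (dsum I F) x" if "v \<in> Mc (dsum I F) x" "{i \<in> I. v i \<noteq> mzero (F i) x} \<subseteq> {}" for v
      using that by (auto simp: dsum_sel)
    then show ?case using zero by blast
  next
    case (insert i J)
    show ?case
    proof (intro ballI impI)
      fix v assume v: "v \<in> Mc (dsum I F) x" "{i \<in> I. v i \<noteq> mzero (F i) x} \<subseteq> insert i J"
      \<comment> \<open>Erasing the i-th coordinate moves the support into J; the erased part is a
        coordinate vector.\<close>
      let ?w = "v(i := mzero (F i) x)"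
      have i: "i \<in> I" "v i \<in> Mc (F i) x" using insert v by (auto simp: dsum_sel)
      have w: "?w \<in> Mc (dsum I F) x"
      proof -
        have "finite {k \<in> I. v k \<noteq> mzero (F k) x}" using v(1) by (simp add: dsum_sel)
        then have "finite {k \<in> I. ?w k \<noteq> mzero (F k) x}"
          by (rule rev_finite_subset) auto
        then show ?thesis
          using v(1) i(1) rmodule.zero_closed[OF F[OF i(1)] x] by (auto simp: dsum_sel)
      qed
      have "v = madd (dsum I F) x (dsingle I F i x (v i)) ?w"
      proof
        fix k
        have "k \<notin> I \<Longrightarrow> v k = undefined" "k \<in> I \<Longrightarrow> v k \<in> Mc (F k) x"
          using v(1) by (auto simp: dsum_sel)
        then show "v k = madd (dsum I F) x (dsingle I F i x (v i)) ?w k"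
          using rmodule.add_0[OF F x] rmodule.add_0_right[OF F x] i
          by (cases "k = i") (simp_all add: dsum_sel dsingle_def)
      qed
      moreover have "P ?w"
      proof -
        have "{k \<in> I. ?w k \<noteq> mzero (F k) x} \<subseteq> J" using v(2) by auto
        then show ?thesis using insert.IH insert.prems w by blast
      qed
      ultimately show "P v"
        using add[OF dsingle_closed[of I R F x i "v i"] w single[OF i]] F x i by simp
    qed
  qed
  then show ?thesis using v by (auto simp: dsum_sel)
qed

section \<open>The first isomorphism theorem\<close>

context rmodule
begin

lemma submod_rmodule:
  assumes "submod R M T"
  shows "rmodule R (M\<lparr>Mc := T\<rparr>)"
proof
  have [simp]: "t \<in> Mc M x" if "x \<in> Ob R" "t \<in> T x" for x t using assms that submodD by metis
  note [simp] = submodD[OF assms]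
  show "is_rmod R (M\<lparr>Mc := T\<rparr>)"
    unfolding is_rmod_def abgrp_on_def
    by (auto simp: assoc act_add act_hadd act_cmp intro: comm)
qed (rule ringoid)

text \<open>The first isomorphism theorem, with the submodule T viewed as the module \<open>M\<lparr>Mc := T\<rparr>\<close>.\<close>

lemma iso_quot_iff:
  assumes "submod R M S" "submod R M T" "\<And>x. x \<in> Ob R \<Longrightarrow> S x \<subseteq> T x" "rmodule R N"
  shows "iso_rmod R (quot R M T S) N \<longleftrightarrow>
    (\<exists>\<psi>. hom_rmod R (M\<lparr>Mc := T\<rparr>) N \<psi> \<and>
      (\<forall>x\<in>Ob R. \<psi> x ` T x = Mc N x \<and> (\<forall>t\<in>T x. \<psi> x t = mzero N x \<longleftrightarrow> t \<in> S x)))"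
proof
  interpret N: rmodule R N by fact
  interpret Q: rmodule R "quot R M T S" by (rule quot_rmodule) fact+
  interpret T: rmodule R "M\<lparr>Mc := T\<rparr>" by (rule submod_rmodule) fact
  have T [simp]: "t \<in> Mc M x" if "x \<in> Ob R" "t \<in> T x" for x t using assms(2) that submodD by metis
  note quot_sel[OF assms(1), simp]
  {
    assume "iso_rmod R (quot R M T S) N"
    then obtain \<phi> where \<phi>: "hom_rmod R (quot R M T S) N \<phi>"
      and b: "\<And>x. x \<in> Ob R \<Longrightarrow> bij_betw (\<phi> x) (Mc (quot R M T S) x) (Mc N x)"
      unfolding iso_rmod_def by blast
    let ?\<psi> = "\<lambda>x t. \<phi> x (coset M S x t)"
    have c: "coset M S x t \<in> Mc (quot R M T S) x" if "t \<in> T x" for x t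
      using that by (simp add: Mc_quot)
    have "hom_rmod R (M\<lparr>Mc := T\<rparr>) N ?\<psi>"
      unfolding hom_rmod_def
      using hom_rmodD(1)[OF \<phi> _ c] hom_rmodD(2)[OF \<phi> _ c c] hom_rmodD(3)[OF \<phi> _ _ _ c] by simp
    moreover have "?\<psi> x ` T x = Mc N x" if "x \<in> Ob R" for x
      using b[OF that] by (simp add: bij_betw_def Mc_quot image_image)
    moreover have "?\<psi> x t = mzero N x \<longleftrightarrow> t \<in> S x" if "x \<in> Ob R" "t \<in> T x" for x t
    proof -
      have "\<phi> x (S x) = mzero N x"
        using hom_zero[OF Q.rmodule_axioms N.rmodule_axioms \<phi> that(1)] by (simp add: mzero_quot)
      then have "?\<psi> x t = mzero N x \<longleftrightarrow> coset M S x t = S x"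
        using inj_on_eq_iff[OF bij_betw_imp_inj_on[OF b[OF that(1)]], of "coset M S x t" "S x"]
          c[OF that(2)] Q.zero_closed[OF that(1)] by (simp add: mzero_quot)
      then show ?thesis using coset_eq_zero_iff[OF assms(1) that(1)] that by simp
    qed
    ultimately show "\<exists>\<psi>. hom_rmod R (M\<lparr>Mc := T\<rparr>) N \<psi> \<and>
      (\<forall>x\<in>Ob R. \<psi> x ` T x = Mc N x \<and> (\<forall>t\<in>T x. \<psi> x t = mzero N x \<longleftrightarrow> t \<in> S x))" by blast
  next
    assume "\<exists>\<psi>. hom_rmod R (M\<lparr>Mc := T\<rparr>) N \<psi> \<and>
      (\<forall>x\<in>Ob R. \<psi> x ` T x = Mc N x \<and> (\<forall>t\<in>T x. \<psi> x t = mzero N x \<longleftrightarrow> t \<in> S x))"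
    then obtain \<psi> where \<psi>: "hom_rmod R (M\<lparr>Mc := T\<rparr>) N \<psi>"
      and surj: "\<And>x. x \<in> Ob R \<Longrightarrow> \<psi> x ` T x = Mc N x"
      and ker: "\<And>x t. x \<in> Ob R \<Longrightarrow> t \<in> T x \<Longrightarrow> \<psi> x t = mzero N x \<longleftrightarrow> t \<in> S x" by blast
    note h = hom_rmodD[OF \<psi>, simplified]
    have [simp]: "madd M x a b \<in> T x" "mneg M x a \<in> T x" if "x \<in> Ob R" "a \<in> T x" "b \<in> T x" for x a b
      using that submodD[OF assms(2)] by auto
    have eq: "\<psi> x a = \<psi> x b \<longleftrightarrow> coset M S x a = coset M S x b"
      if "x \<in> Ob R" "a \<in> T x" "b \<in> T x" for x a b
    proof -
      \<comment> \<open>Writing a as b + (a - b) lets additivity alone compare the two values, with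
        no rule for images of negatives.\<close>
      have "\<psi> x a = \<psi> x (madd M x b (madd M x a (mneg M x b)))"
        using that by (simp add: add_diff)
      also have "\<dots> = madd N x (\<psi> x b) (\<psi> x (madd M x a (mneg M x b)))"
        using that by (simp add: h)
      finally have "\<psi> x a = \<psi> x b \<longleftrightarrow> \<psi> x (madd M x a (mneg M x b)) = mzero N x"
        using N.cancel[of x "\<psi> x b" "\<psi> x (madd M x a (mneg M x b))" "mzero N x"] that
        by (simp add: h)
      then show ?thesis using ker coset_eq_iff[OF assms(1)] that by simp
    qed
    \<comment> \<open>The inverse direction picks a representative of the coset; \<open>eq\<close>
      shows that the choice is immaterial and that the induced map is injective.\<close>
    define \<phi> where "\<phi> x Q = \<psi> x (SOME t. t \<in> T x \<and> Q = coset M S x t)" for x Q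
    have \<phi>: "\<phi> x (coset M S x t) = \<psi> x t" if "x \<in> Ob R" "t \<in> T x" for x t
    proof -
      let ?t = "SOME t'. t' \<in> T x \<and> coset M S x t = coset M S x t'"
      have "?t \<in> T x \<and> coset M S x t = coset M S x ?t"
        by (rule someI[of _ t]) (use that in auto)
      then show ?thesis using eq[of x ?t t] that by (simp add: \<phi>_def)
    qed
    have "hom_rmod R (quot R M T S) N \<phi>"
      using submodD[OF assms(2)] unfolding hom_rmod_def by (auto simp: Mc_quot \<phi> h)
    moreover have "bij_betw (\<phi> x) (Mc (quot R M T S) x) (Mc N x)" if "x \<in> Ob R" for x
      unfolding bij_betw_def inj_on_def Mc_quot using surj[OF that] that eq
      by (auto simp: \<phi> image_image)
    ultimately show "iso_rmod R (quot R M T S) N"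
      unfolding iso_rmod_def by blast
  }
qed

section \<open>Bases of quotients and direct sums of cyclic modules\<close>

text \<open>The sum of the elements \<open>m k\<close> acted on by \<open>f k\<close>, for k < n.
  Families are functions on the naturals with a separate length, so that a generator is appended by
  an update at n and dropped by lowering n.\<close>

primrec comb :: "(nat \<Rightarrow> 'o) \<Rightarrow> (nat \<Rightarrow> 'm) \<Rightarrow> 'o \<Rightarrow> nat \<Rightarrow> (nat \<Rightarrow> 'h) \<Rightarrow> 'm" where
  "comb e m x 0 f = mzero M x"
| "comb e m x (Suc n) f = madd M x (comb e m x n f) (act M x (e n) (f n) (m n))"

lemma comb_cong:
  "(\<And>k. k < n \<Longrightarrow> e k = e' k \<and> m k = m' k \<and> f k = f' k) \<Longrightarrow> comb e m x n f = comb e' m' x n f'"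
  by (induction n) auto

lemma comb_mem:
  assumes "submod R M T" "x \<in> Ob R"
  shows "(\<And>k. k < n \<Longrightarrow> e k \<in> Ob R \<and> m k \<in> T (e k) \<and> f k \<in> Hom R x (e k)) \<Longrightarrow> comb e m x n f \<in> T x"
  using submodD[OF assms] by (induction n) auto

lemma comb_closed [simp]:
  assumes "x \<in> Ob R" "\<And>k. k < n \<Longrightarrow> e k \<in> Ob R" "\<And>k. k < n \<Longrightarrow> m k \<in> Mc M (e k)"
    "\<And>k. k < n \<Longrightarrow> f k \<in> Hom R x (e k)"
  shows "comb e m x n f \<in> Mc M x"
  using comb_mem[OF submod_self assms(1)] assms by simp

lemma comb_add:
  assumes "x \<in> Ob R"
  shows "(\<And>k. k < n \<Longrightarrow> e k \<in> Ob R) \<Longrightarrow> (\<And>k. k < n \<Longrightarrow> m k \<in> Mc M (e k)) \<Longrightarrow>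
    (\<And>k. k < n \<Longrightarrow> f k \<in> Hom R x (e k)) \<Longrightarrow> (\<And>k. k < n \<Longrightarrow> g k \<in> Hom R x (e k)) \<Longrightarrow>
    comb e m x n (\<lambda>k. hadd R (f k) (g k)) = madd M x (comb e m x n f) (comb e m x n g)"
proof (induction n)
  case (Suc n)
  then have "comb e m x n f \<in> Mc M x" "comb e m x n g \<in> Mc M x"
    using assms by (auto intro!: comb_closed)
  with Suc assms show ?case
    by (simp add: act_hadd assoc lcomm[of x "act M x (e n) (f n) (m n)"])
qed (use assms in simp)

lemma comb_neg:
  assumes "x \<in> Ob R"
  shows "(\<And>k. k < n \<Longrightarrow> e k \<in> Ob R) \<Longrightarrow> (\<And>k. k < n \<Longrightarrow> m k \<in> Mc M (e k)) \<Longrightarrow>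
    (\<And>k. k < n \<Longrightarrow> f k \<in> Hom R x (e k)) \<Longrightarrow>
    comb e m x n (\<lambda>k. hneg R (f k)) = mneg M x (comb e m x n f)"
proof (induction n)
  case (Suc n)
  then have "comb e m x n f \<in> Mc M x"
    using assms by (auto intro!: comb_closed)
  with Suc assms show ?case
    by (simp add: act_hneg neg_add)
qed (use assms in simp)

lemma comb_act:
  assumes "x \<in> Ob R" "w \<in> Ob R" "h \<in> Hom R w x"
  shows "(\<And>k. k < n \<Longrightarrow> e k \<in> Ob R) \<Longrightarrow> (\<And>k. k < n \<Longrightarrow> m k \<in> Mc M (e k)) \<Longrightarrow>
    (\<And>k. k < n \<Longrightarrow> f k \<in> Hom R x (e k)) \<Longrightarrow>
    comb e m w n (\<lambda>k. cmp R (f k) h) = act M w x h (comb e m x n f)"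
proof (induction n)
  case (Suc n)
  then have "comb e m x n f \<in> Mc M x"
    using assms by (auto intro!: comb_closed)
  with Suc assms show ?case
    by (simp add: act_add act_cmp[of w x])
qed (use assms in simp)

lemma comb_zero:
  assumes "x \<in> Ob R"
  shows "(\<And>k. k < n \<Longrightarrow> e k \<in> Ob R) \<Longrightarrow> (\<And>k. k < n \<Longrightarrow> m k \<in> Mc M (e k)) \<Longrightarrow>
    comb e m x n (\<lambda>k. hzero R x (e k)) = mzero M x"
  using assms by (induction n) auto

end

section \<open>Cyclic modules and bases\<close>

definition cyc :: "('o, 'h, 'k::comm_ring_1) ringoid \<Rightarrow> 'o \<Rightarrow> ('o \<Rightarrow> 'h set) \<Rightarrow> ('o, 'h, 'h set) rmod" where
  "cyc R e U = quot R (Yo R e) (Mc (Yo R e)) U"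

lemma cyc_rmodule:
  assumes "K_ringoid R" "e \<in> Ob R" "submod R (Yo R e) U"
  shows "rmodule R (cyc R e U)"
  unfolding cyc_def
  using Yo_rmodule[OF assms(1,2)] assms(3) by (intro rmodule.quot_rmodule rmodule.submod_self)

context rmodule
begin

text \<open>The \<open>m k\<close> induce an isomorphism from the direct sum of the \<open>Y(e k)/U k\<close> to T/S.\<close>

definition basis :: "('o \<Rightarrow> 'm set) \<Rightarrow> ('o \<Rightarrow> 'm set) \<Rightarrow> nat \<Rightarrow> (nat \<Rightarrow> 'o) \<Rightarrow>
    (nat \<Rightarrow> 'o \<Rightarrow> 'h set) \<Rightarrow> (nat \<Rightarrow> 'm) \<Rightarrow> bool" where
  "basis S T n e U m \<longleftrightarrow> (\<forall>k<n. e k \<in> Ob R \<and> m k \<in> T (e k)) \<and>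
     (\<forall>x\<in>Ob R. \<forall>t\<in>T x. \<exists>f. (\<forall>k<n. f k \<in> Hom R x (e k)) \<and> (\<exists>s\<in>S x. t = madd M x s (comb e m x n f))) \<and>
     (\<forall>x\<in>Ob R. \<forall>f. (\<forall>k<n. f k \<in> Hom R x (e k)) \<longrightarrow>
        (comb e m x n f \<in> S x \<longleftrightarrow> (\<forall>k<n. f k \<in> U k x)))"

text \<open>A basis is the same as an epimorphism from T to the direct sum with kernel S. Given the
  epimorphism, preimages of the coordinate generators form a basis; given a basis, an element is
  sent to the cosets of its coefficients, and the relations say exactly that this is well defined
  with kernel S.\<close>

lemma basis_iff_epi:
  assumes S: "submod R M S" and T: "submod R M T" and ST: "\<And>x. x \<in> Ob R \<Longrightarrow> S x \<subseteq> T x"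
    and e: "\<And>k. k < n \<Longrightarrow> e k \<in> Ob R" and U: "\<And>k. k < n \<Longrightarrow> submod R (Yo R (e k)) (U k)"
    and N: "N = dsum {..<n} (\<lambda>k. cyc R (e k) (U k))"
  shows "(\<exists>m. basis S T n e U m) \<longleftrightarrow>
    (\<exists>\<psi>. hom_rmod R (M\<lparr>Mc := T\<rparr>) N \<psi> \<and>
      (\<forall>x\<in>Ob R. \<psi> x ` T x = Mc N x \<and> (\<forall>t\<in>T x. \<psi> x t = mzero N x \<longleftrightarrow> t \<in> S x)))"
    (is "?L \<longleftrightarrow> ?R")
proof
  let ?C = "\<lambda>k. cyc R (e k) (U k)"
  let ?c = "\<lambda>k. coset (Yo R (e k)) (U k)"
  have Yo: "rmodule R (Yo R (e k))" if "k < n" for k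
    using Yo_rmodule[OF ringoid] e that by simp
  have C: "rmodule R (?C k)" if "k < n" for k
    using cyc_rmodule[OF ringoid e U] that by simp
  then have CI: "rmodule R (?C k)" if "k \<in> {..<n}" for k
    using that by simp
  interpret N: rmodule R N
    unfolding N using CI by (intro dsum_rmodule ringoid)
  have TM [simp]: "t \<in> Mc M x" if "x \<in> Ob R" "t \<in> T x" for x t using T that submodD by metis
  have SM [simp]: "t \<in> Mc M x" if "x \<in> Ob R" "t \<in> S x" for x t using S that submodD by metis
  note [simp] = submodD[OF T]
  have C_sel: "Mc (?C k) x = ?c k x ` Hom R x (e k)" "mzero (?C k) x = U k x" if "k < n" for k x
    using rmodule.Mc_quot[OF Yo] rmodule.mzero_quot[OF Yo] that by (simp_all add: cyc_def)
  have C_op: "madd (?C k) x (?c k x f) (?c k x g) = ?c k x (hadd R f g)"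
    if "k < n" "x \<in> Ob R" "f \<in> Hom R x (e k)" "g \<in> Hom R x (e k)" for k x f g
    using rmodule.quot_sel(1)[OF Yo U] that by (simp add: cyc_def)
  have C_act: "act (?C k) w x h (?c k x f) = ?c k w (cmp R f h)"
    if "k < n" "x \<in> Ob R" "w \<in> Ob R" "h \<in> Hom R w x" "f \<in> Hom R x (e k)" for k x w f h
    using rmodule.quot_sel(3)[OF Yo U] that by (simp add: cyc_def)
  have c_zero: "?c k x f = U k x \<longleftrightarrow> f \<in> U k x" if "k < n" "x \<in> Ob R" "f \<in> Hom R x (e k)" for k x f
    using rmodule.coset_eq_zero_iff[OF Yo U] that by simp
  have c_eq: "?c k x f = ?c k x g \<longleftrightarrow> hadd R f (hneg R g) \<in> U k x"
    if "k < n" "x \<in> Ob R" "f \<in> Hom R x (e k)" "g \<in> Hom R x (e k)" for k x f g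
    using rmodule.coset_eq_iff[OF Yo U] that by simp
  \<comment> \<open>The cut-off j leaves zero cosets from position j on, so that \<open>vec\<close>
    grows by one coordinate at a time in step with the recursion of \<open>comb\<close>.\<close>
  define vec where "vec x j f = (\<lambda>i. if i < n then if i < j then ?c i x (f i) else U i x else undefined)"
    for x j and f :: "nat \<Rightarrow> 'h"
  have vec0: "vec x 0 f = mzero N x" for x f
    by (rule ext) (simp add: vec_def N dsum_sel C_sel)
  have vecS: "vec x (Suc j) f = madd N x (vec x j f) (dsingle {..<n} ?C j x (?c j x (f j)))"
    if "j < n" "x \<in> Ob R" "\<And>k. k < n \<Longrightarrow> f k \<in> Hom R x (e k)" for x j f
  proof
    fix i
    have "?c i x (f i) \<in> Mc (?C i) x" if "i < n"
      using that \<open>\<And>k. k < n \<Longrightarrow> f k \<in> Hom R x (e k)\<close> by (simp add: C_sel)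
    then show "vec x (Suc j) f i = madd N x (vec x j f) (dsingle {..<n} ?C j x (?c j x (f j))) i"
      using that(2) C_sel rmodule.add_0[OF C] rmodule.add_0_right[OF C] rmodule.zero_closed[OF C]
      by (auto simp: vec_def N dsum_sel dsingle_def)
  qed
  have vec_ex: "\<exists>f. (\<forall>k<n. f k \<in> Hom R x (e k)) \<and> v = vec x n f" if "v \<in> Mc N x" for x v
  proof -
    have "\<forall>k. \<exists>f. k < n \<longrightarrow> f \<in> Hom R x (e k) \<and> v k = ?c k x f"
      using that by (auto simp: N dsum_sel C_sel)
    then obtain f where f: "\<And>k. k < n \<Longrightarrow> f k \<in> Hom R x (e k) \<and> v k = ?c k x (f k)" by metis
    then have "v = vec x n f"
      using that by (intro ext) (simp add: N dsum_sel vec_def)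
    then show ?thesis using f by blast
  qed
  have vec_closed: "vec x n f \<in> Mc N x" if "\<And>k. k < n \<Longrightarrow> f k \<in> Hom R x (e k)" for x f
    using that by (auto simp: N dsum_sel vec_def C_sel)
  have vec_zero: "vec x n f = mzero N x \<longleftrightarrow> (\<forall>k<n. f k \<in> U k x)"
    if "x \<in> Ob R" "\<And>k. k < n \<Longrightarrow> f k \<in> Hom R x (e k)" for x f
    using that c_zero by (auto simp: vec_def N dsum_sel C_sel fun_eq_iff)
  {
    assume ?R
    then obtain \<psi> where \<psi>: "hom_rmod R (M\<lparr>Mc := T\<rparr>) N \<psi>"
      and surj: "\<And>x. x \<in> Ob R \<Longrightarrow> \<psi> x ` T x = Mc N x"
      and ker: "\<And>x t. x \<in> Ob R \<Longrightarrow> t \<in> T x \<Longrightarrow> \<psi> x t = mzero N x \<longleftrightarrow> t \<in> S x" by blast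
    note h = hom_rmodD[OF \<psi>, simplified]
    \<comment> \<open>The class of the identity generates the k-th summand.\<close>
    define u where "u k = dsingle {..<n} ?C k (e k) (?c k (e k) (idm R (e k)))" for k
    have "u k \<in> Mc N (e k)" if "k < n" for k
      unfolding u_def N using CI that e
      by (intro dsingle_closed) (auto simp: C_sel)
    then have "\<forall>k. \<exists>m. k < n \<longrightarrow> m \<in> T (e k) \<and> \<psi> (e k) m = u k"
      using surj e by (metis imageE)
    then obtain m where m: "\<And>k. k < n \<Longrightarrow> m k \<in> T (e k) \<and> \<psi> (e k) (m k) = u k" by metis
    have act_u: "act N x (e k) f (u k) = dsingle {..<n} ?C k x (?c k x f)"
      if "k < n" "x \<in> Ob R" "f \<in> Hom R x (e k)" for k x f
      unfolding u_def N using that e CI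
      by (subst dsingle_act[where R=R]) (auto simp: C_act)
    have comb_T: "comb e m x j f \<in> T x" if "j \<le> n" "x \<in> Ob R" "\<And>k. k < n \<Longrightarrow> f k \<in> Hom R x (e k)" for x j f
      using that m e by (intro comb_mem[OF T]) auto
    have \<psi>_comb: "\<psi> x (comb e m x j f) = vec x j f"
      if "j \<le> n" "x \<in> Ob R" "\<And>k. k < n \<Longrightarrow> f k \<in> Hom R x (e k)" for x j f
      using that(1)
    proof (induction j)
      case 0
      then show ?case
        using ker[OF that(2)] submodD(2)[OF S that(2)] that(2) by (simp add: vec0)
    next
      case (Suc j)
      then show ?case
        using that m[of j] e[of j] comb_T[of j x f] vecS[of j x f] act_u[of j x "f j"]
        by (simp add: h)
    qed
    have "basis S T n e U m"
      unfolding basis_def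
    proof (intro conjI allI impI ballI)
      fix x t assume x: "x \<in> Ob R" and t: "t \<in> T x"
      then obtain f where f: "\<forall>k<n. f k \<in> Hom R x (e k)" "\<psi> x t = vec x n f"
        using vec_ex[of "\<psi> x t" x] h by blast
      let ?g = "comb e m x n f"
      have g: "?g \<in> T x" using comb_T x f by blast
      have d: "madd M x t (mneg M x ?g) \<in> T x" using x t g by simp
      \<comment> \<open>t and \<open>?g\<close> have the same image, so by cancellation their
        difference lies in the kernel, that is, in \<open>S x\<close>.\<close>
      have "madd N x (vec x n f) (\<psi> x (madd M x t (mneg M x ?g)))
          = \<psi> x (madd M x ?g (madd M x t (mneg M x ?g)))"
        using x d g f h(2) \<psi>_comb[of n x f] by simp
      also have "\<dots> = vec x n f" using x t g f by (simp add: add_diff)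
      finally have "\<psi> x (madd M x t (mneg M x ?g)) = mzero N x"
        using N.cancel[of x "vec x n f" "\<psi> x (madd M x t (mneg M x ?g))" "mzero N x"]
          x vec_closed f d h(1) by simp
      then have "madd M x t (mneg M x ?g) \<in> S x" using ker x d by blast
      moreover have "t = madd M x (madd M x t (mneg M x ?g)) ?g"
        using x t g by (simp add: assoc)
      ultimately show "\<exists>f. (\<forall>k<n. f k \<in> Hom R x (e k)) \<and> (\<exists>s\<in>S x. t = madd M x s (comb e m x n f))"
        using f(1) by blast
    next
      fix x f assume x: "x \<in> Ob R" and f: "\<forall>k<n. f k \<in> Hom R x (e k)"
      then show "comb e m x n f \<in> S x \<longleftrightarrow> (\<forall>k<n. f k \<in> U k x)"
        using ker[OF x comb_T[of n x f]] \<psi>_comb[of n x f] vec_zero[of x f] by simp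
    qed (use e m in auto)
    then show ?L by blast
  next
    assume ?L
    then obtain m where m: "\<And>k. k < n \<Longrightarrow> m k \<in> T (e k)"
      and span: "\<And>x t. x \<in> Ob R \<Longrightarrow> t \<in> T x \<Longrightarrow>
          \<exists>f. (\<forall>k<n. f k \<in> Hom R x (e k)) \<and> (\<exists>s\<in>S x. t = madd M x s (comb e m x n f))"
      and indep: "\<And>x f. x \<in> Ob R \<Longrightarrow> (\<forall>k<n. f k \<in> Hom R x (e k)) \<Longrightarrow>
          comb e m x n f \<in> S x \<longleftrightarrow> (\<forall>k<n. f k \<in> U k x)"
      unfolding basis_def by blast
    define adm where "adm x f \<longleftrightarrow> (\<forall>k<n. f k \<in> Hom R x (e k))" for x f
    define P where "P x t f \<longleftrightarrow> adm x f \<and> (\<exists>s\<in>S x. t = madd M x s (comb e m x n f))" for x t f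
    define \<psi> where "\<psi> x t = vec x n (SOME f. P x t f)" for x t
    have P_ex: "\<exists>f. P x t f" if "x \<in> Ob R" "t \<in> T x" for x t
      using span[OF that] by (simp add: P_def adm_def)
    have cT: "comb e m x n f \<in> T x" if "x \<in> Ob R" "adm x f" for x f
      using that m e by (intro comb_mem[OF T]) (auto simp: adm_def)
    have cM: "comb e m x n f \<in> Mc M x" if "x \<in> Ob R" "adm x f" for x f
      using cT that by simp
    have cadd: "comb e m x n (\<lambda>k. hadd R (f k) (g k)) = madd M x (comb e m x n f) (comb e m x n g)"
      and cneg: "comb e m x n (\<lambda>k. hneg R (g k)) = mneg M x (comb e m x n g)"
      if "x \<in> Ob R" "adm x f" "adm x g" for x f g
      using that m e by (auto simp: adm_def intro!: comb_add comb_neg)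
    have adm: "adm x (\<lambda>k. hadd R (f k) (g k))" "adm x (\<lambda>k. hneg R (g k))"
      if "x \<in> Ob R" "adm x f" "adm x g" for x f g
      using that e by (auto simp: adm_def)
    have admc: "adm w (\<lambda>k. cmp R (f k) h)"
      if "x \<in> Ob R" "w \<in> Ob R" "h \<in> Hom R w x" "adm x f" for x w h f
      using that e by (auto simp: adm_def)
    \<comment> \<open>Coefficients of t are not unique, but two choices differ by a combination
      lying in \<open>S x\<close>, and independence puts each coordinate difference into
      \<open>U k x\<close>.\<close>
    have uniq: "vec x n f = vec x n g" if x: "x \<in> Ob R" and Pfg: "P x t f" "P x t g" for x t f g
    proof -
      obtain s s' where s: "s \<in> S x" "s' \<in> S x" "t = madd M x s (comb e m x n f)"
         "t = madd M x s' (comb e m x n g)" and fg: "adm x f" "adm x g"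
        using Pfg unfolding P_def by blast
      let ?d = "madd M x (comb e m x n f) (mneg M x (comb e m x n g))"
      have "madd M x s ?d = s'"
        using s x cM[OF x fg(1)] cM[OF x fg(2)] SM[OF x s(1)] SM[OF x s(2)]
        by (metis assoc neg_closed add_neg_right add_0_right)
      then have "?d \<in> S x"
        using submod_add_cancel(2)[OF S x, of ?d s] s x cM[OF x fg(1)] cM[OF x fg(2)] by simp
      then have "comb e m x n (\<lambda>k. hadd R (f k) (hneg R (g k))) \<in> S x"
        using cadd[OF x fg(1) adm(2)[OF x fg]] cneg[OF x fg] by simp
      then have "\<forall>k<n. hadd R (f k) (hneg R (g k)) \<in> U k x"
        using indep[OF x adm(1)[OF x fg(1) adm(2)[OF x fg], unfolded adm_def]] by simp
      then show ?thesis
        using c_eq x fg by (auto simp: vec_def adm_def fun_eq_iff)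
    qed
    have \<psi>: "\<psi> x t = vec x n f" if "x \<in> Ob R" "P x t f" for x t f
      unfolding \<psi>_def by (rule uniq[OF that(1) someI[of "P x t", OF that(2)] that(2)])
    have hom: "hom_rmod R (M\<lparr>Mc := T\<rparr>) N \<psi>"
      unfolding hom_rmod_def
    proof (intro conjI ballI; simp)
      fix x t assume x: "x \<in> Ob R" and t: "t \<in> T x"
      then obtain f where f: "P x t f" using P_ex by metis
      then have "vec x n f \<in> Mc N x" by (intro vec_closed) (simp add: P_def adm_def)
      then show "\<psi> x t \<in> Mc N x" using \<psi>[OF x f] by simp
    next
      fix x t t' assume x: "x \<in> Ob R" and t: "t \<in> T x" "t' \<in> T x"
      then obtain f g where f: "P x t f" "P x t' g" using P_ex by metis
      obtain s s' where s: "s \<in> S x" "s' \<in> S x" "t = madd M x s (comb e m x n f)"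
         "t' = madd M x s' (comb e m x n g)" and fg: "adm x f" "adm x g"
        using f unfolding P_def by blast
      have "P x (madd M x t t') (\<lambda>k. hadd R (f k) (g k))"
        unfolding P_def
      proof (intro conjI bexI[of _ "madd M x s s'"])
        show "adm x (\<lambda>k. hadd R (f k) (g k))" using adm(1)[OF x fg] .
        show "madd M x t t' = madd M x (madd M x s s') (comb e m x n (\<lambda>k. hadd R (f k) (g k)))"
          using s x cM[OF x fg(1)] cM[OF x fg(2)] cadd[OF x fg]
          by (simp add: assoc lcomm[of x "comb e m x n f"])
        show "madd M x s s' \<in> S x" using submodD[OF S x] s by blast
      qed
      then show "\<psi> x (madd M x t t') = madd N x (\<psi> x t) (\<psi> x t')"
        using \<psi>[OF x] f fg x by (auto simp: vec_def N dsum_sel C_op adm_def fun_eq_iff)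
    next
      fix w x h t assume w: "w \<in> Ob R" and x: "x \<in> Ob R" and h: "h \<in> Hom R w x" and t: "t \<in> T x"
      then obtain f where f: "P x t f" using P_ex by metis
      then obtain s where s: "s \<in> S x" "t = madd M x s (comb e m x n f)" and fg: "adm x f"
        unfolding P_def by blast
      have "P w (act M w x h t) (\<lambda>k. cmp R (f k) h)"
        unfolding P_def
      proof (intro conjI bexI[of _ "act M w x h s"])
        show "adm w (\<lambda>k. cmp R (f k) h)" using admc[OF x w h fg] .
        have "comb e m w n (\<lambda>k. cmp R (f k) h) = act M w x h (comb e m x n f)"
          using x w h fg m e by (intro comb_act) (auto simp: adm_def)
        then show "act M w x h t = madd M w (act M w x h s) (comb e m w n (\<lambda>k. cmp R (f k) h))"
          using s x w h cM[OF x fg] by (simp add: act_add)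
        show "act M w x h s \<in> S w" using submodD[OF S w] s x h by blast
      qed
      then show "\<psi> w (act M w x h t) = act N w x h (\<psi> x t)"
        using \<psi>[OF w] \<psi>[OF x f] f fg x w h by (auto simp: vec_def N dsum_sel C_act adm_def fun_eq_iff)
    qed
    have "\<psi> x ` T x = Mc N x" if x: "x \<in> Ob R" for x
    proof
      show "\<psi> x ` T x \<subseteq> Mc N x"
        using hom_rmodD(1)[OF hom x] by auto
      show "Mc N x \<subseteq> \<psi> x ` T x"
      proof
        fix v assume "v \<in> Mc N x"
        then obtain f where f: "adm x f" "v = vec x n f" using vec_ex unfolding adm_def by blast
        then have "P x (comb e m x n f) f"
          unfolding P_def using cM[OF x] submodD(2)[OF S x] x by force
        then show "v \<in> \<psi> x ` T x" using \<psi>[OF x] cT[OF x f(1)] f(2) by (metis imageI)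
      qed
    qed
    moreover have "\<psi> x t = mzero N x \<longleftrightarrow> t \<in> S x" if x: "x \<in> Ob R" and t: "t \<in> T x" for x t
    proof -
      obtain f where f: "P x t f" using P_ex[OF x t] by blast
      then obtain s where s: "s \<in> S x" "t = madd M x s (comb e m x n f)" and fg: "adm x f"
        unfolding P_def by blast
      have "t \<in> S x \<longleftrightarrow> comb e m x n f \<in> S x"
        using submod_add_cancel(2)[OF S x cM[OF x fg] s(1)] s(2) by simp
      also have "\<dots> \<longleftrightarrow> (\<forall>k<n. f k \<in> U k x)"
        using indep[OF x fg[unfolded adm_def]] .
      also have "\<dots> \<longleftrightarrow> \<psi> x t = mzero N x"
        using vec_zero[OF x] fg \<psi>[OF x f] unfolding adm_def by simp
      finally show ?thesis by simp
    qed
    ultimately show ?R using hom by blast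
  }
qed

lemma iso_quot_iff_basis:
  assumes "submod R M S" "submod R M T" "\<And>x. x \<in> Ob R \<Longrightarrow> S x \<subseteq> T x"
    and "\<And>k. k < n \<Longrightarrow> e k \<in> Ob R" "\<And>k. k < n \<Longrightarrow> submod R (Yo R (e k)) (U k)"
  shows "iso_rmod R (quot R M T S) (dsum {..<n} (\<lambda>k. cyc R (e k) (U k))) \<longleftrightarrow> (\<exists>m. basis S T n e U m)"
proof -
  have "rmodule R (dsum {..<n} (\<lambda>k. cyc R (e k) (U k)))"
    using cyc_rmodule[OF ringoid assms(4,5)] by (intro dsum_rmodule ringoid) auto
  from iso_quot_iff[OF assms(1-3) this] show ?thesis
    using basis_iff_epi[where N="dsum {..<n} (\<lambda>k. cyc R (e k) (U k))", OF assms refl] by simp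
qed

end

section \<open>Traces as generated submodules\<close>

text \<open>The condition on N inside the intersection that defines \<open>trace\<close>. It can be
  decomposed along a direct sum before the intersection is taken.\<close>

definition trace_le :: "('o, 'h, 'k) ringoid \<Rightarrow> ('o, 'h, 'p) rmod \<Rightarrow> ('o, 'h, 'm) rmod \<Rightarrow>
    ('o \<Rightarrow> 'm set) \<Rightarrow> bool" where
  "trace_le R P M N \<longleftrightarrow> (\<forall>\<phi>. hom_rmod R P M \<phi> \<longrightarrow> (\<forall>y\<in>Ob R. \<phi> y ` Mc P y \<subseteq> N y))"

context rmodule
begin

text \<open>A map on a summand extends to the sum through the projection, with the same image; a map
  on the sum is determined by its restrictions to the summands, since coordinate vectors
  generate.\<close>

lemma trace_le_dsum:
  assumes N: "submod R M N" and F: "\<And>i. i \<in> I \<Longrightarrow> rmodule R (F i)"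
  shows "trace_le R (dsum I F) M N \<longleftrightarrow> (\<forall>i\<in>I. trace_le R (F i) M N)"
proof
  assume L: "trace_le R (dsum I F) M N"
  show "\<forall>i\<in>I. trace_le R (F i) M N"
    unfolding trace_le_def
  proof (intro ballI allI impI subsetI)
    fix i \<phi> y b assume i: "i \<in> I" and \<phi>: "hom_rmod R (F i) M \<phi>" and y: "y \<in> Ob R"
      and "b \<in> \<phi> y ` Mc (F i) y"
    then obtain a where a: "a \<in> Mc (F i) y" "b = \<phi> y a" by blast
    have "hom_rmod R (dsum I F) M (\<lambda>y v. \<phi> y (v i))"
      using \<phi> i unfolding hom_rmod_def by (simp add: dsum_sel)
    then have "(\<lambda>v. \<phi> y (v i)) ` Mc (dsum I F) y \<subseteq> N y"
      using L y unfolding trace_le_def by blast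
    moreover have "dsingle I F i y a \<in> Mc (dsum I F) y"
      using dsingle_closed[of I R F] F y i a by simp
    moreover have "dsingle I F i y a i = a" using i by (simp add: dsingle_def)
    ultimately show "b \<in> N y" using a by force
  qed
next
  assume A: "\<forall>i\<in>I. trace_le R (F i) M N"
  have D: "rmodule R (dsum I F)" by (rule dsum_rmodule) (auto simp: ringoid F)
  show "trace_le R (dsum I F) M N"
    unfolding trace_le_def
  proof (intro ballI allI impI subsetI)
    fix \<phi> y b assume \<phi>: "hom_rmod R (dsum I F) M \<phi>" and y: "y \<in> Ob R"
      and "b \<in> \<phi> y ` Mc (dsum I F) y"
    then obtain v where v: "v \<in> Mc (dsum I F) y" "b = \<phi> y v" by blast
    have "\<phi> y v \<in> N y"
    proof (rule dsum_induct[where R=R and I=I and F=F, OF _ y v(1)])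
      show "\<phi> y (mzero (dsum I F) y) \<in> N y"
        using hom_zero[OF D rmodule_axioms \<phi> y] submodD(2)[OF N y] by simp
    next
      fix v w assume "v \<in> Mc (dsum I F) y" "w \<in> Mc (dsum I F) y" "\<phi> y v \<in> N y" "\<phi> y w \<in> N y"
      then show "\<phi> y (madd (dsum I F) y v w) \<in> N y"
        using hom_rmodD(2)[OF \<phi> y] submodD(3)[OF N y] by simp
    next
      fix i a assume single: "i \<in> I" "a \<in> Mc (F i) y"
      have "hom_rmod R (F i) M (\<lambda>y a. \<phi> y (dsingle I F i y a))"
        unfolding hom_rmod_def
        using hom_rmodD[OF \<phi>] dsingle_closed[of I R F _ i] dsingle_add[of I R F _ i]
          dsingle_act[of I R F _ _ _ i] F single(1)
        by metis
      then show "\<phi> y (dsingle I F i y a) \<in> N y"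
        using A single y unfolding trace_le_def by blast
    qed (rule F)
    then show "b \<in> N y" using v by simp
  qed
qed

text \<open>Yoneda: maps out of \<open>Yo R e\<close> correspond to elements of
  \<open>Mc M e\<close>, namely the images of the identity, and these generate the images of the
  maps.\<close>

lemma trace_le_Yo:
  assumes N: "submod R M N" and e: "e \<in> Ob R"
  shows "trace_le R (Yo R e) M N \<longleftrightarrow> Mc M e \<subseteq> N e"
proof
  assume L: "trace_le R (Yo R e) M N"
  show "Mc M e \<subseteq> N e"
  proof
    fix m assume m: "m \<in> Mc M e"
    have "hom_rmod R (Yo R e) M (\<lambda>x f. act M x e f m)"
      unfolding hom_rmod_def using m e by (simp add: act_hadd act_cmp)
    then have "(\<lambda>f. act M e e f m) ` Hom R e e \<subseteq> N e"
      using L e unfolding trace_le_def by force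
    then have "act M e e (idm R e) m \<in> N e" using e id_closed by blast
    then show "m \<in> N e" using m e by simp
  qed
next
  assume A: "Mc M e \<subseteq> N e"
  show "trace_le R (Yo R e) M N"
    unfolding trace_le_def
  proof (intro ballI allI impI subsetI)
    fix \<phi> y b assume \<phi>: "hom_rmod R (Yo R e) M \<phi>" and y: "y \<in> Ob R"
      and "b \<in> \<phi> y ` Mc (Yo R e) y"
    then obtain f where f: "f \<in> Hom R y e" "b = \<phi> y f" by auto
    then have "b = act M y e f (\<phi> e (idm R e))"
      using hom_rmodD(3)[OF \<phi> y e f(1), of "idm R e"] y e by simp
    moreover have "\<phi> e (idm R e) \<in> N e" using hom_rmodD(1)[OF \<phi> e] A e by auto
    ultimately show "b \<in> N y" using submodD(5)[OF N y e f(1)] by simp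
  qed
qed

section \<open>Submodules generated at a set of objects\<close>

text \<open>For \<open>S = Mc M\<close> this is a trace of M. For a submodule S it is the trace of S
  computed among the submodules of M, so that all steps of a filtration can be compared in one
  place. Only the values of S on X enter.\<close>

definition gen :: "'o set \<Rightarrow> ('o \<Rightarrow> 'm set) \<Rightarrow> 'o \<Rightarrow> 'm set" where
  "gen X S x = \<Inter> {N x | N. submod R M N \<and> (\<forall>e\<in>X. S e \<subseteq> N e)}"

lemma gen_least: "submod R M N \<Longrightarrow> (\<And>e. e \<in> X \<Longrightarrow> S e \<subseteq> N e) \<Longrightarrow> gen X S x \<subseteq> N x"
  unfolding gen_def by blast

lemma gen_incl: "e \<in> X \<Longrightarrow> S e \<subseteq> gen X S e"
  unfolding gen_def by blast

lemma gen_mono: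
  assumes "X \<subseteq> X'" "\<And>e. e \<in> X \<Longrightarrow> S e \<subseteq> S' e"
  shows "gen X S x \<subseteq> gen X' S' x"
proof -
  have "S e \<subseteq> N e" if "\<forall>e\<in>X'. S' e \<subseteq> N e" "e \<in> X" for N e
    using that assms by blast
  then show ?thesis unfolding gen_def by blast
qed

lemma gen_cong: "(\<And>e. e \<in> X \<Longrightarrow> S e = S' e) \<Longrightarrow> gen X S = gen X S'"
  by (intro ext equalityI gen_mono) auto

lemma gen_submod:
  assumes "submod R M S" "X \<subseteq> Ob R"
  shows "submod R M (gen X S)"
proof -
  have S: "gen X S x \<subseteq> S x" for x by (rule gen_least) (use assms in auto)
  show ?thesis
    unfolding submod_def
  proof (intro conjI ballI)
    fix x assume "x \<in> Ob R"
    then show "gen X S x \<subseteq> Mc M x" using S submodD(1)[OF assms(1)] by blast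
  qed (auto simp: gen_def dest: submodD)
qed

text \<open>\<open>tau\<close> is the trace of a sum of sums of representables, so the reduction to
  summands is made twice before the Yoneda lemma applies.\<close>

lemma trace_dsum_Yo:
  assumes "\<And>j c. j \<in> I \<Longrightarrow> c \<in> C j \<Longrightarrow> g c \<in> Ob R"
  shows "trace R (dsum I (\<lambda>j. dsum (C j) (\<lambda>c. Yo R (g c)))) M = gen (\<Union>j\<in>I. g ` C j) (Mc M)"
    (is "trace R ?P M = _")
proof -
  have "trace_le R ?P M N \<longleftrightarrow> (\<forall>e\<in>\<Union>j\<in>I. g ` C j. Mc M e \<subseteq> N e)" if N: "submod R M N" for N
  proof -
    have Y: "rmodule R (Yo R (g c))" if "j \<in> I" "c \<in> C j" for j c
      by (rule Yo_rmodule[OF ringoid assms[OF that]])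
    then have "rmodule R (dsum (C j) (\<lambda>c. Yo R (g c)))" if "j \<in> I" for j
      using that by (intro dsum_rmodule ringoid)
    then have "trace_le R ?P M N \<longleftrightarrow> (\<forall>j\<in>I. trace_le R (dsum (C j) (\<lambda>c. Yo R (g c))) M N)"
      by (intro trace_le_dsum N)
    also have "\<dots> \<longleftrightarrow> (\<forall>j\<in>I. \<forall>c\<in>C j. trace_le R (Yo R (g c)) M N)"
      by (intro ball_cong refl trace_le_dsum N Y)
    also have "\<dots> \<longleftrightarrow> (\<forall>j\<in>I. \<forall>c\<in>C j. Mc M (g c) \<subseteq> N (g c))"
      using trace_le_Yo[OF N] assms by simp
    finally show ?thesis by simp
  qed
  then show ?thesis
    unfolding trace_def gen_def trace_le_def[symmetric] by (intro ext) (simp cong: conj_cong)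
qed

text \<open>S/A is cyclic, generated by the class of p, with annihilator U.\<close>

definition cyclic_ext :: "('o \<Rightarrow> 'm set) \<Rightarrow> ('o \<Rightarrow> 'm set) \<Rightarrow> 'o \<Rightarrow> ('o \<Rightarrow> 'h set) \<Rightarrow> 'm \<Rightarrow> bool" where
  "cyclic_ext A S e U p \<longleftrightarrow> e \<in> Ob R \<and> p \<in> S e \<and>
     (\<forall>x\<in>Ob R. \<forall>t\<in>S x. \<exists>f\<in>Hom R x e. \<exists>a\<in>A x. t = madd M x a (act M x e f p)) \<and>
     (\<forall>x\<in>Ob R. \<forall>f\<in>Hom R x e. act M x e f p \<in> A x \<longleftrightarrow> f \<in> U x)"

section \<open>Splitting a basis into cyclic extensions\<close>

lemma comb_single:
  assumes "x \<in> Ob R"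
  shows "(\<And>l. l < n \<Longrightarrow> e l \<in> Ob R) \<Longrightarrow> (\<And>l. l < n \<Longrightarrow> m l \<in> Mc M (e l)) \<Longrightarrow> k < n \<Longrightarrow>
    f \<in> Hom R x (e k) \<Longrightarrow>
    comb e m x n (\<lambda>l. if l = k then f else hzero R x (e l)) = act M x (e k) f (m k)"
proof (induction n)
  case (Suc n)
  show ?case
  proof (cases "k = n")
    case True
    have "comb e m x n (\<lambda>l. if l = k then f else hzero R x (e l)) = comb e m x n (\<lambda>l. hzero R x (e l))"
      using True by (intro comb_cong) auto
    also have "\<dots> = mzero M x" using Suc.prems assms by (intro comb_zero) auto
    finally show ?thesis using True Suc.prems assms by simp
  next
    case False
    then show ?thesis using Suc assms by simp
  qed
qed simp

text \<open>Take S' generated over S by all basis elements but the last. A relation placing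
  \<open>m n\<close> times f in S' becomes, after moving the earlier terms to the left, a relation
  modulo S among all n + 1 elements; hence the annihilator of the last one over S' is still
  \<open>U n\<close>.\<close>

lemma basis_init:
  assumes S: "submod R M S" and T: "submod R M T" and ST: "\<And>x. x \<in> Ob R \<Longrightarrow> S x \<subseteq> T x"
    and b: "basis S T (Suc n) e U m" and U: "\<And>k. k < n \<Longrightarrow> submod R (Yo R (e k)) (U k)"
  obtains S' where "submod R M S'" "\<And>x. x \<in> Ob R \<Longrightarrow> S x \<subseteq> S' x" "\<And>x. x \<in> Ob R \<Longrightarrow> S' x \<subseteq> T x"
    "basis S S' n e U m" "cyclic_ext S' T (e n) (U n) (m n)"
proof
  define S' where "S' x = {madd M x s (comb e m x n f) | s f. s \<in> S x \<and> (\<forall>k<n. f k \<in> Hom R x (e k))}" for x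
  have SM [simp]: "t \<in> Mc M x" if "x \<in> Ob R" "t \<in> S x" for x t using S that submodD by metis
  have e [simp]: "e k \<in> Ob R" and mT: "m k \<in> T (e k)" if "k < Suc n" for k
    using b that unfolding basis_def by blast+
  have m [simp]: "m k \<in> Mc M (e k)" if "k < Suc n" for k
    using e mT that submodD(1)[OF T] by blast
  have span: "\<exists>f. (\<forall>k<Suc n. f k \<in> Hom R x (e k)) \<and> (\<exists>s\<in>S x. t = madd M x s (comb e m x (Suc n) f))"
    if "x \<in> Ob R" "t \<in> T x" for x t
    using b that unfolding basis_def by blast
  have indep: "comb e m x (Suc n) f \<in> S x \<longleftrightarrow> (\<forall>k<Suc n. f k \<in> U k x)"
    if "x \<in> Ob R" "\<forall>k<Suc n. f k \<in> Hom R x (e k)" for x f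
    using b that unfolding basis_def by blast
  have cM: "comb e m x n f \<in> Mc M x" if "x \<in> Ob R" "\<forall>k<n. f k \<in> Hom R x (e k)" for x f
    using that by (intro comb_closed) auto
  have S'I: "madd M x s (comb e m x n f) \<in> S' x" if "s \<in> S x" "\<forall>k<n. f k \<in> Hom R x (e k)" for x s f
    using that unfolding S'_def by blast
  have combS': "comb e m x n f \<in> S' x" if "x \<in> Ob R" "\<forall>k<n. f k \<in> Hom R x (e k)" for x f
    using S'I[OF submodD(2)[OF S that(1)] that(2)] cM[OF that] that(1) by simp
  show S': "submod R M S'"
    unfolding submod_def
  proof (intro conjI ballI)
    fix x assume x: "x \<in> Ob R"
    show "S' x \<subseteq> Mc M x"
      using cM[OF x] x by (auto simp: S'_def)
    have "comb e m x n (\<lambda>k. hzero R x (e k)) = mzero M x"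
      using x by (intro comb_zero) auto
    then show "mzero M x \<in> S' x"
      using combS'[OF x, of "\<lambda>k. hzero R x (e k)"] x by simp
    fix a assume "a \<in> S' x"
    then obtain s f where a: "a = madd M x s (comb e m x n f)" "s \<in> S x" "\<forall>k<n. f k \<in> Hom R x (e k)"
      unfolding S'_def by blast
    have "mneg M x a = madd M x (mneg M x s) (comb e m x n (\<lambda>k. hneg R (f k)))"
      using a x cM[OF x a(3)] comb_neg[OF x, of n e m f] by (simp add: neg_add)
    then show "mneg M x a \<in> S' x"
      using S'I[of "mneg M x s" x "\<lambda>k. hneg R (f k)"] submodD(4)[OF S x a(2)] a(3) x by simp
    fix a' assume "a' \<in> S' x"
    then obtain s' f' where a': "a' = madd M x s' (comb e m x n f')" "s' \<in> S x" "\<forall>k<n. f' k \<in> Hom R x (e k)"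
      unfolding S'_def by blast
    have "madd M x a a' = madd M x (madd M x s s') (comb e m x n (\<lambda>k. hadd R (f k) (f' k)))"
      using a a' x cM[OF x a(3)] cM[OF x a'(3)] comb_add[OF x, of n e m f f']
      by (simp add: assoc lcomm[of x "comb e m x n f"])
    then show "madd M x a a' \<in> S' x"
      using S'I[of "madd M x s s'" x "\<lambda>k. hadd R (f k) (f' k)"] submodD(3)[OF S x a(2) a'(2)] a(3) a'(3) x
      by simp
  next
    fix w x h a assume w: "w \<in> Ob R" and x: "x \<in> Ob R" and h: "h \<in> Hom R w x" and "a \<in> S' x"
    then obtain s f where a: "a = madd M x s (comb e m x n f)" "s \<in> S x" "\<forall>k<n. f k \<in> Hom R x (e k)"
      unfolding S'_def by blast
    have "act M w x h a = madd M w (act M w x h s) (comb e m w n (\<lambda>k. cmp R (f k) h))"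
      using a x w h cM[OF x a(3)] comb_act[OF x w h, of n e m f] by (simp add: act_add)
    then show "act M w x h a \<in> S' w"
      using S'I[of "act M w x h s" w "\<lambda>k. cmp R (f k) h"] submodD(5)[OF S w x h a(2)] a(3) x w h
      by (simp add: cmp_closed[of w x])
  qed
  show SS': "S x \<subseteq> S' x" if x: "x \<in> Ob R" for x
  proof
    fix s assume "s \<in> S x"
    moreover have "comb e m x n (\<lambda>k. hzero R x (e k)) = mzero M x"
      using x by (intro comb_zero) auto
    ultimately show "s \<in> S' x"
      using S'I[of s x "\<lambda>k. hzero R x (e k)"] x by simp
  qed
  have cT: "comb e m x n f \<in> T x" if "x \<in> Ob R" "\<forall>k<n. f k \<in> Hom R x (e k)" for x f
    using that mT by (intro comb_mem[OF T]) auto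
  show "S' x \<subseteq> T x" if x: "x \<in> Ob R" for x
    using cT[OF x] ST[OF x] submodD(3)[OF T x] unfolding S'_def by blast
  have U0: "hzero R x (e k) \<in> U k x" if "x \<in> Ob R" "k < n" for x k
    using submodD(2)[OF U that(1)] that by simp
  show "basis S S' n e U m"
    unfolding basis_def
  proof (intro conjI allI impI ballI)
    fix k assume k: "k < n"
    show "m k \<in> S' (e k)"
      using comb_single[of "e k" n e m k "idm R (e k)"]
        combS'[of "e k" "\<lambda>l. if l = k then idm R (e k) else hzero R (e k) (e l)"] k by simp
  next
    fix x t assume "x \<in> Ob R" "t \<in> S' x"
    then show "\<exists>f. (\<forall>k<n. f k \<in> Hom R x (e k)) \<and> (\<exists>s\<in>S x. t = madd M x s (comb e m x n f))"
      unfolding S'_def by blast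
  next
    fix x f assume x: "x \<in> Ob R" and f: "\<forall>k<n. f k \<in> Hom R x (e k)"
    have "comb e m x (Suc n) (f(n := hzero R x (e n))) = comb e m x n f"
      using comb_cong[of n e e m m "f(n := hzero R x (e n))" f x] cM[OF x f] x by simp
    \<comment> \<open>The hypothesis on U covers k < n only; that zero lies in \<open>U n x\<close>
      is read off from the trivial relation.\<close>
    moreover have "hzero R x (e n) \<in> U n x"
    proof -
      have "comb e m x (Suc n) (\<lambda>k. hzero R x (e k)) = mzero M x"
        using x by (intro comb_zero) auto
      then show ?thesis
        using indep[of x "\<lambda>k. hzero R x (e k)"] submodD(2)[OF S x] x by simp
    qed
    ultimately show "comb e m x n f \<in> S x \<longleftrightarrow> (\<forall>k<n. f k \<in> U k x)"
      using indep[of x "f(n := hzero R x (e n))"] f x by (auto simp: less_Suc_eq)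
  qed auto
  show "cyclic_ext S' T (e n) (U n) (m n)"
    unfolding cyclic_ext_def
  proof (intro conjI ballI)
    fix x t assume x: "x \<in> Ob R" and "t \<in> T x"
    then obtain f s where f: "\<forall>k<Suc n. f k \<in> Hom R x (e k)" "s \<in> S x" "t = madd M x s (comb e m x (Suc n) f)"
      using span by blast
    then have "t = madd M x (madd M x s (comb e m x n f)) (act M x (e n) (f n) (m n))"
      using x cM[OF x, of f] by (simp add: assoc)
    moreover have "madd M x s (comb e m x n f) \<in> S' x" using S'I f by simp
    ultimately show "\<exists>f\<in>Hom R x (e n). \<exists>a\<in>S' x. t = madd M x a (act M x (e n) f (m n))"
      using f(1) by blast
  next
    fix x f assume x: "x \<in> Ob R" and f: "f \<in> Hom R x (e n)"
    show "act M x (e n) f (m n) \<in> S' x \<longleftrightarrow> f \<in> U n x"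
    proof
      assume "act M x (e n) f (m n) \<in> S' x"
      then obtain s g where g: "act M x (e n) f (m n) = madd M x s (comb e m x n g)" "s \<in> S x"
        "\<forall>k<n. g k \<in> Hom R x (e k)"
        unfolding S'_def by blast
      \<comment> \<open>With these coefficients the equation becomes a combination equal to s, hence
        lying in \<open>S x\<close>.\<close>
      let ?g = "(\<lambda>k. hneg R (g k))(n := f)"
      have "comb e m x n ?g = comb e m x n (\<lambda>k. hneg R (g k))"
        by (intro comb_cong) auto
      also have "\<dots> = mneg M x (comb e m x n g)" using x g by (intro comb_neg) auto
      finally have "comb e m x (Suc n) ?g = s"
        using g x cM[OF x g(3)] comm[of x s] by simp
      then show "f \<in> U n x"
        using indep[OF x, of ?g] g f x by (auto simp: less_Suc_eq)
    next
      assume "f \<in> U n x"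
      let ?g = "(\<lambda>k. hzero R x (e k))(n := f)"
      have "comb e m x n ?g = comb e m x n (\<lambda>k. hzero R x (e k))"
        by (intro comb_cong) auto
      also have "\<dots> = mzero M x" using x by (intro comb_zero) auto
      finally have "comb e m x (Suc n) ?g = act M x (e n) f (m n)"
        using x f by simp
      moreover have "comb e m x (Suc n) ?g \<in> S x"
        using indep[OF x, of ?g] U0[OF x] \<open>f \<in> U n x\<close> f x by (auto simp: less_Suc_eq)
      ultimately show "act M x (e n) f (m n) \<in> S' x" using SS'[OF x] by auto
    qed
  qed (use mT in auto)
qed

text \<open>Peeling off the last generator repeatedly reduces a step with many summands to cyclic
  ones. The premise \<open>cong\<close> is there because submodules are functions on the whole type,
  and with no generator left S and T are known to agree at objects only.\<close>

lemma basis_chain_induct: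
  assumes S: "submod R M S" and T: "submod R M T" and ST: "\<And>x. x \<in> Ob R \<Longrightarrow> S x \<subseteq> T x"
    and b: "basis S T n e U m" and U: "\<And>k. k < n \<Longrightarrow> submod R (Yo R (e k)) (U k)"
    and base: "Q S"
    and cong: "\<And>A A'. Q A \<Longrightarrow> (\<And>x. x \<in> Ob R \<Longrightarrow> A x = A' x) \<Longrightarrow> Q A'"
    and step: "\<And>A A' k. submod R M A \<Longrightarrow> submod R M A' \<Longrightarrow> (\<And>x. x \<in> Ob R \<Longrightarrow> A x \<subseteq> A' x) \<Longrightarrow>
       k < n \<Longrightarrow> cyclic_ext A A' (e k) (U k) (m k) \<Longrightarrow> Q A \<Longrightarrow> Q A'"
  shows "Q T"
  using T ST b U step
proof (induction n arbitrary: T)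
  case 0
  have "S x = T x" if x: "x \<in> Ob R" for x
  proof
    show "T x \<subseteq> S x"
      using 0 x submodD(1)[OF S x] unfolding basis_def by fastforce
  qed (use 0 x in blast)
  then show ?case using cong[OF base] by blast
next
  case (Suc n)
  obtain S' where "submod R M S'" "\<And>x. x \<in> Ob R \<Longrightarrow> S x \<subseteq> S' x" "\<And>x. x \<in> Ob R \<Longrightarrow> S' x \<subseteq> T x"
    "basis S S' n e U m" "cyclic_ext S' T (e n) (U n) (m n)"
    by (rule basis_init[OF S Suc.prems(1-3)]) (use Suc.prems(4) in auto)
  note S' = this
  have "Q S'"
  proof (rule Suc.IH[OF S'(1,2,4)])
    show "submod R (Yo R (e k)) (U k)" if "k < n" for k
      using Suc.prems(4) that by simp
    show "Q A'" if "submod R M A" "submod R M A'" "\<And>x. x \<in> Ob R \<Longrightarrow> A x \<subseteq> A' x" "k < n"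
      "cyclic_ext A A' (e k) (U k) (m k)" "Q A" for A A' k
      using Suc.prems(5)[OF that(1-3) _ that(5,6)] that(4) by simp
  qed
  then show ?case
    using Suc.prems(5)[OF S'(1) Suc.prems(1) S'(3) _ S'(5)] by simp
qed

end

section \<open>Stratification by a well-ordered family of generators\<close>

text \<open>\<open>G i\<close> stands for the chosen representatives of the i-th section.\<close>

locale stratified = rmodule R M
  for R :: "('o, 'h, 'k::comm_ring_1) ringoid" and M :: "('o, 'h, 'm) rmod" +
  fixes r :: "'i rel" and G :: "'i \<Rightarrow> 'o set"
  assumes wo: "Well_order r" and G_Ob: "G i \<subseteq> Ob R"
begin

definition le :: "'i \<Rightarrow> 'o set" where "le i = (\<Union>j\<in>{j. (j, i) \<in> r}. G j)"

definition lt :: "'i \<Rightarrow> 'o set" where "lt i = (\<Union>j\<in>{j. (j, i) \<in> r \<and> j \<noteq> i}. G j)"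

text \<open>The denominator of the standard module at e. The locale has its module fixed to M, so
  \<open>gen\<close> is taken from the locale of \<open>Yo R e\<close>.\<close>

definition yo_trace :: "'i \<Rightarrow> 'o \<Rightarrow> 'o \<Rightarrow> 'h set" where
  "yo_trace i e = rmodule.gen R (Yo R e) (lt i) (\<lambda>x. Hom R x e)"

lemma le_Ob: "le i \<subseteq> Ob R" and lt_Ob: "lt i \<subseteq> Ob R" and lt_le: "lt i \<subseteq> le i"
  using G_Ob by (auto simp: le_def lt_def)

lemma trans: "(i, j) \<in> r \<Longrightarrow> (j, k) \<in> r \<Longrightarrow> (i, k) \<in> r"
  and antisym: "(i, j) \<in> r \<Longrightarrow> (j, i) \<in> r \<Longrightarrow> i = j"
  and total: "i \<in> Field r \<Longrightarrow> j \<in> Field r \<Longrightarrow> (i, j) \<in> r \<or> (j, i) \<in> r"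
  and refl: "i \<in> Field r \<Longrightarrow> (i, i) \<in> r"
proof -
  have "trans r" "antisym r" "total_on (Field r) r" "refl_on (Field r) r"
    using wo
    by (simp_all add: well_order_on_def linear_order_on_def partial_order_on_def preorder_on_def)
  note o = transD[OF this(1)] antisymD[OF this(2)] this(3)[unfolded total_on_def] refl_onD[OF this(4)]
  show "(i, j) \<in> r \<Longrightarrow> (j, k) \<in> r \<Longrightarrow> (i, k) \<in> r" by (rule o(1))
  show "(i, j) \<in> r \<Longrightarrow> (j, i) \<in> r \<Longrightarrow> i = j" by (rule o(2))
  show refl: "i \<in> Field r \<Longrightarrow> (i, i) \<in> r" for i by (rule o(4))
  show "i \<in> Field r \<Longrightarrow> j \<in> Field r \<Longrightarrow> (i, j) \<in> r \<or> (j, i) \<in> r"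
    using o(3) refl[of i] by (cases "i = j") simp_all
qed

lemma le_mono: "(i, j) \<in> r \<Longrightarrow> le i \<subseteq> le j"
  unfolding le_def by (auto intro: trans)

lemma le_lt: "(i, j) \<in> r \<Longrightarrow> i \<noteq> j \<Longrightarrow> le i \<subseteq> lt j"
  unfolding le_def lt_def using antisym[of i j] by (auto intro: trans)

lemma G_le: "(i, j) \<in> r \<Longrightarrow> G i \<subseteq> le j"
  unfolding le_def by blast

lemma yo_trace_submod: "e \<in> Ob R \<Longrightarrow> submod R (Yo R e) (yo_trace i e)"
  unfolding yo_trace_def using rmodule.gen_submod[OF Yo_rmodule[OF ringoid] _ lt_Ob]
    rmodule.submod_self[OF Yo_rmodule[OF ringoid], of e] by simp

definition layer_basis :: "('o \<Rightarrow> 'm set) \<Rightarrow> 'i \<Rightarrow> bool" where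
  "layer_basis S i \<longleftrightarrow> (\<exists>n e m. (\<forall>k<n. e k \<in> G i) \<and>
     basis (gen (lt i) S) (gen (le i) S) n e (\<lambda>k. yo_trace i (e k)) m)"

text \<open>Condition (b) for a submodule S of M, in the form that is carried along a filtration.
  One index at which the trace is everything suffices, because traces increase with the
  index.\<close>

definition layered :: "('o \<Rightarrow> 'm set) \<Rightarrow> bool" where
  "layered S \<longleftrightarrow> (\<exists>i0\<in>Field r. \<forall>x\<in>Ob R. gen (le i0) S x = S x) \<and>
     finite {i \<in> Field r. \<exists>x\<in>Ob R. gen (le i) S x \<noteq> gen (lt i) S x} \<and>
     (\<forall>i\<in>Field r. layer_basis S i)"

lemma layered_cong:
  assumes "layered A" "\<And>x. x \<in> Ob R \<Longrightarrow> A x = A' x"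
  shows "layered A'"
proof -
  have "gen (le i) A = gen (le i) A'" "gen (lt i) A = gen (lt i) A'" for i
    using le_Ob lt_Ob assms(2) by (intro gen_cong; blast)+
  then show ?thesis
    using assms unfolding layered_def layer_basis_def by simp
qed

text \<open>The start of the induction: each layer has the empty basis, and the nonempty field
  supplies the index at which the trace is everything.\<close>

lemma layered_zero:
  assumes "Field r \<noteq> {}"
  shows "layered (\<lambda>x. {mzero M x})"
proof -
  have z: "gen X (\<lambda>x. {mzero M x}) x = {mzero M x}" if "X \<subseteq> Ob R" "x \<in> Ob R" for X x
  proof
    show "gen X (\<lambda>x. {mzero M x}) x \<subseteq> {mzero M x}"
      by (rule gen_least[where N="\<lambda>x. {mzero M x}"]) (auto simp: submod_zero)
    show "{mzero M x} \<subseteq> gen X (\<lambda>x. {mzero M x}) x"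
      using submodD(2)[OF gen_submod[OF submod_zero that(1)] that(2)] by simp
  qed
  have "basis (gen (lt i) (\<lambda>x. {mzero M x})) (gen (le i) (\<lambda>x. {mzero M x})) 0 e V m" for i e V m
    unfolding basis_def using z[OF le_Ob] z[OF lt_Ob] by simp
  then have "layer_basis (\<lambda>x. {mzero M x}) i" for i
    unfolding layer_basis_def by (intro exI[of _ 0]) blast
  then show ?thesis
    unfolding layered_def using assms z[OF le_Ob] z[OF lt_Ob] by auto
qed

end

section \<open>Extending by one standard module\<close>

text \<open>The element p lives at an object of level j and its annihilator modulo A is the trace
  strictly below j, so S/A is a copy of a standard module of level j.\<close>

locale cyclic_step = stratified R M r G
  for R :: "('o, 'h, 'k::comm_ring_1) ringoid" and M :: "('o, 'h, 'm) rmod"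
    and r :: "'i rel" and G :: "'i \<Rightarrow> 'o set" +
  fixes A S :: "'o \<Rightarrow> 'm set" and j :: 'i and e :: 'o and p :: 'm
  assumes A: "submod R M A" and S: "submod R M S" and AS: "x \<in> Ob R \<Longrightarrow> A x \<subseteq> S x"
    and j: "j \<in> Field r" and eG: "e \<in> G j" and ext: "cyclic_ext A S e (yo_trace j e) p"
begin

lemma e [simp]: "e \<in> Ob R" using eG G_Ob by blast
lemma pS: "p \<in> S e" using ext unfolding cyclic_ext_def by blast
lemma p [simp]: "p \<in> Mc M e" using pS submodD(1)[OF S e] by blast
lemma span: "x \<in> Ob R \<Longrightarrow> t \<in> S x \<Longrightarrow> \<exists>f\<in>Hom R x e. \<exists>a\<in>A x. t = madd M x a (act M x e f p)"
  using ext by (simp add: cyclic_ext_def)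
lemma indep: "x \<in> Ob R \<Longrightarrow> f \<in> Hom R x e \<Longrightarrow> act M x e f p \<in> A x \<longleftrightarrow> f \<in> yo_trace j e x"
  using ext by (simp add: cyclic_ext_def)

lemma Yo: "rmodule R (Yo R e)"
  by (rule Yo_rmodule[OF ringoid e])

text \<open>Every morphism z -> e from an object strictly below j lies in the trace of Y(e), hence
  annihilates p modulo A.\<close>

lemma SA: "z \<in> lt j \<Longrightarrow> S z \<subseteq> A z"
proof
  fix t assume z: "z \<in> lt j" and "t \<in> S z"
  then have zO: "z \<in> Ob R" using lt_Ob by blast
  then obtain f a where f: "f \<in> Hom R z e" "a \<in> A z" "t = madd M z a (act M z e f p)"
    using span \<open>t \<in> S z\<close> by blast
  have "f \<in> yo_trace j e z"
    unfolding yo_trace_def using rmodule.gen_incl[OF Yo z, of "\<lambda>x. Hom R x e"] f(1) by (rule subsetD)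
  then have "act M z e f p \<in> A z" using indep[OF zO f(1)] by simp
  then show "t \<in> A z" using f submodD(3)[OF A zO] by blast
qed

text \<open>The crucial point. The f carrying p into the trace of A strictly below j form a
  submodule of Y(e). At z in \<open>lt j\<close> it is all of Hom(z, e), since there the values land
  in \<open>S z\<close>, which is contained in \<open>A z\<close> by \<open>SA\<close>. So it
  contains the trace of Y(e).\<close>

lemma yo_trace_act:
  assumes "x \<in> Ob R" "f \<in> yo_trace j e x"
  shows "act M x e f p \<in> gen (lt j) A x"
proof -
  let ?Z = "gen (lt j) A"
  note Z = submodD[OF gen_submod[OF A lt_Ob[of j]]]
  let ?N = "\<lambda>x. {f \<in> Hom R x e. act M x e f p \<in> ?Z x}"
  have "submod R (Yo R e) ?N"
    unfolding submod_def
    using Z by (auto simp: act_hadd act_hneg act_cmp[of _ _ e])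
  moreover have "Hom R z e \<subseteq> ?N z" if z: "z \<in> lt j" for z
  proof -
    have zO: "z \<in> Ob R" using z lt_Ob by blast
    have "act M z e f p \<in> ?Z z" if "f \<in> Hom R z e" for f
      using submodD(5)[OF S zO e that pS] SA[OF z] gen_incl[OF z, of A] by blast
    then show ?thesis by blast
  qed
  ultimately have "yo_trace j e x \<subseteq> ?N x"
    unfolding yo_trace_def by (rule rmodule.gen_least[OF Yo])
  then show ?thesis using assms by blast
qed

lemma act_in_A:
  assumes "x \<in> Ob R" "f \<in> Hom R x e" "act M x e f p \<in> A x" "lt j \<subseteq> X"
  shows "act M x e f p \<in> gen X A x"
proof -
  have "f \<in> yo_trace j e x" using indep[OF assms(1,2)] assms(3) by simp
  then have "act M x e f p \<in> gen (lt j) A x" by (rule yo_trace_act[OF assms(1)])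
  then show ?thesis using gen_mono[OF assms(4) subset_refl] by (rule subsetD[rotated])
qed

lemma gen_low:
  assumes "X \<subseteq> lt j"
  shows "gen X S = gen X A"
proof (rule gen_cong)
  fix z assume "z \<in> X"
  then have "z \<in> lt j" using assms by blast
  then show "S z = A z" using SA[of z] AS[of z] lt_Ob[of j] by blast
qed

section \<open>Layers after adjoining the new generator\<close>

definition adjoin :: "('o \<Rightarrow> 'm set) \<Rightarrow> 'o \<Rightarrow> 'm set" where
  "adjoin N x = {madd M x n (act M x e f p) | n f. n \<in> N x \<and> f \<in> Hom R x e}"

lemma adjoinI: "n \<in> N x \<Longrightarrow> f \<in> Hom R x e \<Longrightarrow> madd M x n (act M x e f p) \<in> adjoin N x"
  unfolding adjoin_def by blast

lemma adjoin_submod: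
  assumes "submod R M N"
  shows "submod R M (adjoin N)"
  unfolding submod_def
proof (intro conjI ballI)
  have NM [simp]: "t \<in> Mc M x" if "x \<in> Ob R" "t \<in> N x" for x t using assms that submodD by metis
  {
    fix x assume x: "x \<in> Ob R"
    show "adjoin N x \<subseteq> Mc M x" using x by (auto simp: adjoin_def)
    show "mzero M x \<in> adjoin N x"
      using adjoinI[where N=N, OF submodD(2)[OF assms x], of "hzero R x e"] x by simp
    fix a assume "a \<in> adjoin N x"
    then obtain n f where a: "a = madd M x n (act M x e f p)" "n \<in> N x" "f \<in> Hom R x e"
      unfolding adjoin_def by blast
    show "mneg M x a \<in> adjoin N x"
      using adjoinI[where N=N, OF submodD(4)[OF assms x a(2)], of "hneg R f"] a x by (simp add: neg_add act_hneg)
    fix b assume "b \<in> adjoin N x"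
    then obtain n' f' where b: "b = madd M x n' (act M x e f' p)" "n' \<in> N x" "f' \<in> Hom R x e"
      unfolding adjoin_def by blast
    have "madd M x a b = madd M x (madd M x n n') (act M x e (hadd R f f') p)"
      using a b x by (simp add: act_hadd assoc lcomm[of x "act M x e f p"])
    then show "madd M x a b \<in> adjoin N x"
      using adjoinI[where N=N, OF submodD(3)[OF assms x a(2) b(2)], of "hadd R f f'"] a b x by simp
  }
  fix w x h a assume w: "w \<in> Ob R" and x: "x \<in> Ob R" and h: "h \<in> Hom R w x" and "a \<in> adjoin N x"
  then obtain n f where a: "a = madd M x n (act M x e f p)" "n \<in> N x" "f \<in> Hom R x e"
    unfolding adjoin_def by blast
  show "act M w x h a \<in> adjoin N w"
    using adjoinI[where N=N, OF submodD(5)[OF assms w x h a(2)], of "cmp R f h"] a w x h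
    by (simp add: act_add act_cmp[of w x] cmp_closed[of w x])
qed

text \<open>Once e belongs to X, p itself is a generator, and every element of S at an object of X
  is an element of A plus a multiple of p.\<close>

lemma gen_high:
  assumes "e \<in> X" "X \<subseteq> Ob R" "x \<in> Ob R"
  shows "gen X S x = adjoin (gen X A) x"
proof
  note g = gen_submod[OF A assms(2)]
  have "S z \<subseteq> adjoin (gen X A) z" if z: "z \<in> X" for z
  proof
    fix t assume "t \<in> S z"
    then show "t \<in> adjoin (gen X A) z"
      using span[of z t] z assms(2) gen_incl[OF z, of A] adjoinI by blast
  qed
  then show "gen X S x \<subseteq> adjoin (gen X A) x"
    by (intro gen_least adjoin_submod g)
  have "gen X A x \<subseteq> gen X S x"
    using AS assms(2) by (intro gen_mono) auto
  moreover have "act M x e f p \<in> gen X S x" if "f \<in> Hom R x e" for f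
    using submodD(5)[OF gen_submod[OF S assms(2)] assms(3) e that] pS gen_incl[OF assms(1), of S] by blast
  ultimately show "adjoin (gen X A) x \<subseteq> gen X S x"
    using submodD(3)[OF gen_submod[OF S assms(2)] assms(3)] unfolding adjoin_def by blast
qed

lemma basis_cong:
  assumes "basis S' T' n e' V m'" "\<And>x. x \<in> Ob R \<Longrightarrow> S' x = S'' x" "\<And>x. x \<in> Ob R \<Longrightarrow> T' x = T'' x"
  shows "basis S'' T'' n e' V m'"
proof -
  have "\<forall>k<n. e' k \<in> Ob R \<and> m' k \<in> T' (e' k)" using assms(1) unfolding basis_def by blast
  then have "\<forall>k<n. m' k \<in> T'' (e' k)" using assms(3) by auto
  then show ?thesis using assms unfolding basis_def by simp
qed

lemma gen_sub: "gen X A x \<subseteq> A x"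
  by (rule gen_least[OF A]) auto

text \<open>Above j the new generator p is added to numerator and denominator, so the old basis survives.\<close>

lemma layer_basis_high:
  assumes i: "(j, i) \<in> r" "i \<noteq> j" and b: "layer_basis A i"
  shows "layer_basis S i"
proof -
  obtain n e' m' where e': "\<forall>k<n. e' k \<in> G i"
    and b: "basis (gen (lt i) A) (gen (le i) A) n e' (\<lambda>k. yo_trace i (e' k)) m'"
    using b unfolding layer_basis_def by blast
  have elt: "e \<in> lt i" using i eG G_le[OF refl[OF j]] le_lt[of j i] by blast
  then have ele: "e \<in> le i" using lt_le by blast
  have jlt: "lt j \<subseteq> lt i" using i le_lt[of j i] lt_le by blast
  have m'T: "e' k \<in> Ob R \<and> m' k \<in> gen (le i) A (e' k)" if "k < n" for k
    using b that unfolding basis_def by blast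
  have L: "submod R M (gen (lt i) A)" and T: "submod R M (gen (le i) A)"
    using gen_submod[OF A] lt_Ob le_Ob by blast+
  have LM [simp]: "t \<in> Mc M x" if "x \<in> Ob R" "t \<in> gen (lt i) A x" for x t using L that submodD by metis
  have c: "comb e' m' x n f \<in> gen (le i) A x" if "x \<in> Ob R" "\<forall>k<n. f k \<in> Hom R x (e' k)" for x f
    using that m'T by (intro comb_mem[OF T]) auto
  then have cM: "comb e' m' x n f \<in> Mc M x" if "x \<in> Ob R" "\<forall>k<n. f k \<in> Hom R x (e' k)" for x f
    using that submodD(1)[OF T] by blast
  \<comment> \<open>Enlarging the denominator by p creates no new relation: the multiple of p
    involved is a difference of two elements of A, so by \<open>act_in_A\<close> it was in the old
    denominator already.\<close>
  have adjoin_L: "comb e' m' x n f \<in> adjoin (gen (lt i) A) x \<longleftrightarrow> comb e' m' x n f \<in> gen (lt i) A x"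
    if x: "x \<in> Ob R" and f: "\<forall>k<n. f k \<in> Hom R x (e' k)" for x f
  proof
    assume "comb e' m' x n f \<in> adjoin (gen (lt i) A) x"
    then obtain a g where g: "comb e' m' x n f = madd M x a (act M x e g p)"
      "a \<in> gen (lt i) A x" "g \<in> Hom R x e" unfolding adjoin_def by blast
    have "madd M x a (act M x e g p) \<in> A x" using g(1) c[OF x f] gen_sub by auto
    then have "act M x e g p \<in> A x"
      using submod_add_cancel(2)[OF A x, of "act M x e g p" a] g gen_sub x by auto
    then have "act M x e g p \<in> gen (lt i) A x"
      using act_in_A[OF x g(3)] jlt by blast
    then show "comb e' m' x n f \<in> gen (lt i) A x" using g submodD(3)[OF L x] by simp
  next
    assume "comb e' m' x n f \<in> gen (lt i) A x"
    from adjoinI[where N="gen (lt i) A", OF this, of "hzero R x e"] show "comb e' m' x n f \<in> adjoin (gen (lt i) A) x"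
      using x cM[OF x f] by simp
  qed
  have "basis (adjoin (gen (lt i) A)) (adjoin (gen (le i) A)) n e' (\<lambda>k. yo_trace i (e' k)) m'"
    unfolding basis_def
  proof (intro conjI allI impI ballI)
    fix k assume "k < n"
    then show "e' k \<in> Ob R" "m' k \<in> adjoin (gen (le i) A) (e' k)"
      using m'T[of k] adjoinI[of "m' k" "gen (le i) A" "e' k" "hzero R (e' k) e"] submodD(1)[OF T] by auto
  next
    fix x t assume x: "x \<in> Ob R" and "t \<in> adjoin (gen (le i) A) x"
    then obtain a g where g: "t = madd M x a (act M x e g p)" "a \<in> gen (le i) A x" "g \<in> Hom R x e"
      unfolding adjoin_def by blast
    obtain f s where f: "\<forall>k<n. f k \<in> Hom R x (e' k)" "s \<in> gen (lt i) A x" "a = madd M x s (comb e' m' x n f)"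
      using b x g(2) unfolding basis_def by blast
    \<comment> \<open>The multiple of p is absorbed into the enlarged denominator; the coefficients
      stay those of a.\<close>
    have "t = madd M x (madd M x s (act M x e g p)) (comb e' m' x n f)"
      using f g x cM[OF x f(1)] by (simp add: assoc comm[of x "comb e' m' x n f"])
    then show "\<exists>f. (\<forall>k<n. f k \<in> Hom R x (e' k)) \<and>
        (\<exists>s\<in>adjoin (gen (lt i) A) x. t = madd M x s (comb e' m' x n f))"
      using f(1) adjoinI[of s "gen (lt i) A" x g] f(2) g(3) by blast
  next
    fix x f assume x: "x \<in> Ob R" and f: "\<forall>k<n. f k \<in> Hom R x (e' k)"
    have "comb e' m' x n f \<in> gen (lt i) A x \<longleftrightarrow> (\<forall>k<n. f k \<in> yo_trace i (e' k) x)"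
      using b x f unfolding basis_def by blast
    then show "comb e' m' x n f \<in> adjoin (gen (lt i) A) x \<longleftrightarrow> (\<forall>k<n. f k \<in> yo_trace i (e' k) x)"
      using adjoin_L[OF x f] by simp
  qed
  then have "basis (gen (lt i) S) (gen (le i) S) n e' (\<lambda>k. yo_trace i (e' k)) m'"
    by (rule basis_cong) (simp_all add: gen_high elt ele lt_Ob le_Ob)
  then show ?thesis using e' unfolding layer_basis_def by blast
qed

text \<open>At level j the numerator gains p while the denominator stays, so p is appended to the
  old basis. Independence survives because a relation between p and the old elements splits into two
  separate ones.\<close>

lemma layer_basis_same:
  assumes b: "layer_basis A j"
  shows "layer_basis S j"
proof -
  obtain n e' m' where e': "\<forall>k<n. e' k \<in> G j"
    and b: "basis (gen (lt j) A) (gen (le j) A) n e' (\<lambda>k. yo_trace j (e' k)) m'"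
    using b unfolding layer_basis_def by blast
  let ?L = "gen (lt j) A" and ?T = "gen (le j) A"
  let ?e = "e'(n := e)" and ?m = "m'(n := p)"
  have ele: "e \<in> le j" using eG G_le[OF refl[OF j]] by blast
  have m'T: "e' k \<in> Ob R \<and> m' k \<in> ?T (e' k)" if "k < n" for k
    using b that unfolding basis_def by blast
  have L: "submod R M ?L" and T: "submod R M ?T"
    using gen_submod[OF A] lt_Ob le_Ob by blast+
  have LM [simp]: "t \<in> Mc M x" if "x \<in> Ob R" "t \<in> ?L x" for x t using L that submodD by metis
  have c: "comb e' m' x n f \<in> ?T x" if "x \<in> Ob R" "\<forall>k<n. f k \<in> Hom R x (e' k)" for x f
    using that m'T by (intro comb_mem[OF T]) auto
  then have cM: "comb e' m' x n f \<in> Mc M x" if "x \<in> Ob R" "\<forall>k<n. f k \<in> Hom R x (e' k)" for x f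
    using that submodD(1)[OF T] by blast
  have comb: "comb ?e ?m x (Suc n) f = madd M x (comb e' m' x n f) (act M x e (f n) p)" for x f
    using comb_cong[of n ?e e' ?m m' f f x] by simp
  have H: "(\<forall>k<Suc n. f k \<in> Hom R x (?e k)) \<longleftrightarrow> (\<forall>k<n. f k \<in> Hom R x (e' k)) \<and> f n \<in> Hom R x e" for x f
    by (auto simp: less_Suc_eq)
  have V: "(\<forall>k<Suc n. f k \<in> yo_trace j (?e k) x) \<longleftrightarrow> (\<forall>k<n. f k \<in> yo_trace j (e' k) x) \<and> f n \<in> yo_trace j e x" for x f
    by (auto simp: less_Suc_eq)
  have "basis ?L (adjoin ?T) (Suc n) ?e (\<lambda>k. yo_trace j (?e k)) ?m"
    unfolding basis_def H V
  proof (intro conjI allI impI ballI)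
    fix k assume k: "k < Suc n"
    show "?e k \<in> Ob R" using k m'T by (auto simp: less_Suc_eq)
    show "?m k \<in> adjoin ?T (?e k)"
    proof (cases "k = n")
      case True
      then show ?thesis
        using adjoinI[where N="gen (le j) A", OF submodD(2)[OF T e], of "idm R e"] by simp
    next
      case False
      then show ?thesis
        using m'T[of k] adjoinI[of "m' k" ?T "e' k" "hzero R (e' k) e"] submodD(1)[OF T] k by auto
    qed
  next
    fix x t assume x: "x \<in> Ob R" and "t \<in> adjoin ?T x"
    then obtain a g where g: "t = madd M x a (act M x e g p)" "a \<in> ?T x" "g \<in> Hom R x e"
      unfolding adjoin_def by blast
    obtain f s where f: "\<forall>k<n. f k \<in> Hom R x (e' k)" "s \<in> ?L x" "a = madd M x s (comb e' m' x n f)"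
      using b x g(2) unfolding basis_def by blast
    have "comb e' m' x n (f(n := g)) = comb e' m' x n f" by (intro comb_cong) auto
    then have "t = madd M x s (comb ?e ?m x (Suc n) (f(n := g)))"
      using f g x cM[OF x f(1)] by (simp only: comb) (simp add: assoc)
    then show "\<exists>f. ((\<forall>k<n. f k \<in> Hom R x (e' k)) \<and> f n \<in> Hom R x e) \<and>
        (\<exists>s\<in>?L x. t = madd M x s (comb ?e ?m x (Suc n) f))"
      using f(1,2) g(3) by (intro exI[of _ "f(n := g)"]) auto
  next
    fix x f assume x: "x \<in> Ob R" and f: "(\<forall>k<n. f k \<in> Hom R x (e' k)) \<and> f n \<in> Hom R x e"
    have b': "comb e' m' x n f \<in> ?L x \<longleftrightarrow> (\<forall>k<n. f k \<in> yo_trace j (e' k) x)"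
      using b x f unfolding basis_def by blast
    have u: "act M x e (f n) p \<in> ?L x \<longleftrightarrow> f n \<in> yo_trace j e x"
      using yo_trace_act[OF x] indep[OF x, of "f n"] f gen_sub by blast
    show "comb ?e ?m x (Suc n) f \<in> ?L x \<longleftrightarrow> (\<forall>k<n. f k \<in> yo_trace j (e' k) x) \<and> f n \<in> yo_trace j e x"
    proof
      assume "comb ?e ?m x (Suc n) f \<in> ?L x"
      then have s: "madd M x (comb e' m' x n f) (act M x e (f n) p) \<in> ?L x" by (simp only: comb)
      \<comment> \<open>The old part lies in A, which forces the multiple of p into A, hence into
        the denominator; subtracting it leaves a relation among the old elements.\<close>
      have cf: "comb e' m' x n f \<in> A x" and fM: "act M x e (f n) p \<in> Mc M x"
        using c[OF x] f x gen_sub by auto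
      have "madd M x (comb e' m' x n f) (act M x e (f n) p) \<in> A x" using s gen_sub by blast
      then have "act M x e (f n) p \<in> A x"
        using submod_add_cancel(2)[OF A x fM cf] by simp
      then have "act M x e (f n) p \<in> ?L x" using indep[OF x, of "f n"] u f by simp
      moreover from this have "comb e' m' x n f \<in> ?L x"
        using submod_add_cancel(1)[OF L x cM[OF x]] f s by simp
      ultimately show "(\<forall>k<n. f k \<in> yo_trace j (e' k) x) \<and> f n \<in> yo_trace j e x" using b' u by blast
    next
      assume "(\<forall>k<n. f k \<in> yo_trace j (e' k) x) \<and> f n \<in> yo_trace j e x"
      then show "comb ?e ?m x (Suc n) f \<in> ?L x"
        using b' u submodD(3)[OF L x] unfolding comb by simp
    qed
  qed
  then have "basis (gen (lt j) S) (gen (le j) S) (Suc n) ?e (\<lambda>k. yo_trace j (?e k)) ?m"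
    by (rule basis_cong) (simp_all add: gen_high gen_low ele lt_Ob le_Ob)
  moreover have "\<forall>k<Suc n. ?e k \<in> G j" using e' eG by (auto simp: less_Suc_eq)
  ultimately show ?thesis unfolding layer_basis_def by blast
qed

lemma layer_basis_low:
  assumes "(i, j) \<in> r" "i \<noteq> j" "layer_basis A i"
  shows "layer_basis S i"
proof -
  have "gen (le i) S = gen (le i) A" by (rule gen_low[OF le_lt[OF assms(1,2)]])
  moreover have "gen (lt i) S = gen (lt i) A"
    by (rule gen_low[OF order_trans[OF lt_le le_lt[OF assms(1,2)]]])
  ultimately show ?thesis
    using assms(3) unfolding layer_basis_def by simp
qed

lemma layered_step:
  assumes "layered A"
  shows "layered S"
  unfolding layered_def
proof (intro conjI ballI)
  fix i assume i: "i \<in> Field r"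
  then have "layer_basis A i" using assms unfolding layered_def by blast
  then show "layer_basis S i"
    using total[OF i j] layer_basis_low layer_basis_same layer_basis_high by (cases "i = j") auto
next
  \<comment> \<open>Away from j a layer that vanishes for A vanishes for S: either both traces are
    unchanged, or both are enlarged by p. So j is the only possible new jump.\<close>
  have eq: "gen (le i) S x = gen (lt i) S x"
    if i: "i \<in> Field r" "i \<noteq> j" and x: "x \<in> Ob R" and A: "\<forall>x\<in>Ob R. gen (le i) A x = gen (lt i) A x" for i x
  proof (cases "(i, j) \<in> r")
    case True
    then show ?thesis
      using gen_low[of "lt i"] gen_low[of "le i"] le_lt[OF True i(2)] lt_le[of i] x A by auto
  next
    case False
    then have "e \<in> lt i" using total[OF i(1) j] i eG G_le[OF refl[OF j]] le_lt[of j i] by blast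
    moreover from this have "e \<in> le i" using lt_le by blast
    ultimately show ?thesis
      using A x by (simp add: gen_high lt_Ob le_Ob adjoin_def)
  qed
  have "finite {i \<in> Field r. \<exists>x\<in>Ob R. gen (le i) A x \<noteq> gen (lt i) A x}"
    using assms unfolding layered_def by blast
  then show "finite {i \<in> Field r. \<exists>x\<in>Ob R. gen (le i) S x \<noteq> gen (lt i) S x}"
    by (rule rev_finite_subset[OF finite.insertI[of _ j]]) (use eq in blast)
next
  obtain i0 where i0: "i0 \<in> Field r" "\<And>x. x \<in> Ob R \<Longrightarrow> gen (le i0) A x = A x"
    using assms unfolding layered_def by blast
  \<comment> \<open>An index above \<open>i0\<close> and j sees all of A and also the new generator
    p.\<close>
  obtain i where i: "i \<in> Field r" "(i0, i) \<in> r" "(j, i) \<in> r"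
    using total[OF i0(1) j] refl i0(1) j by blast
  have ele: "e \<in> le i" using eG G_le[OF i(3)] by blast
  have "gen (le i) S x = S x" if x: "x \<in> Ob R" for x
  proof
    show "gen (le i) S x \<subseteq> S x" by (rule gen_least[OF S]) auto
    show "S x \<subseteq> gen (le i) S x"
    proof
      fix t assume "t \<in> S x"
      then obtain f a where f: "f \<in> Hom R x e" "a \<in> A x" "t = madd M x a (act M x e f p)"
        using span[OF x] by blast
      have "a \<in> gen (le i) A x"
        using gen_mono[OF le_mono[OF i(2)], of A A x] i0(2)[OF x] f(2) by blast
      then show "t \<in> gen (le i) S x"
        using adjoinI f by (simp add: gen_high[OF ele le_Ob x])
    qed
  qed
  then show "\<exists>i0\<in>Field r. \<forall>x\<in>Ob R. gen (le i0) S x = S x" using i(1) by blast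
qed

end

section \<open>Filtrations and the equivalence\<close>

context rmodule
begin

lemma basis_annihilator_cong:
  assumes "\<And>k. k < n \<Longrightarrow> V k = V' k"
  shows "basis S T n e V m = basis S T n e V' m"
  using assms unfolding basis_def by simp

text \<open>X holds pairs rather than modules, so that each summand carries the object and
  annihilator by which a basis element is described.\<close>

lemma in_addcls_iff_basis:
  assumes S: "submod R M S" and T: "submod R M T" and ST: "\<And>x. x \<in> Ob R \<Longrightarrow> S x \<subseteq> T x"
    and X: "\<And>e V. (e, V) \<in> X \<Longrightarrow> e \<in> Ob R \<and> submod R (Yo R e) V"
  shows "in_addcls R ((\<lambda>(e, V). cyc R e V) ` X) (quot R M T S) \<longleftrightarrow>
    (\<exists>n e V m. (\<forall>k<n. (e k, V k) \<in> X) \<and> basis S T n e V m)"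
proof
  assume "in_addcls R ((\<lambda>(e, V). cyc R e V) ` X) (quot R M T S)"
  then obtain Ls where Ls: "set Ls \<subseteq> (\<lambda>(e, V). cyc R e V) ` X"
    and iso: "iso_rmod R (quot R M T S) (dsum {..<length Ls} (nth Ls))"
    unfolding in_addcls_def by blast
  have "\<forall>k. \<exists>w. k < length Ls \<longrightarrow> w \<in> X \<and> Ls ! k = cyc R (fst w) (snd w)"
    using Ls nth_mem by (fastforce simp: case_prod_beta)
  then obtain w where w: "\<And>k. k < length Ls \<Longrightarrow> w k \<in> X \<and> Ls ! k = cyc R (fst (w k)) (snd (w k))"
    by metis
  have "dsum {..<length Ls} (nth Ls) = dsum {..<length Ls} (\<lambda>k. cyc R (fst (w k)) (snd (w k)))"
    using w by (intro dsum_cong) simp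
  then have "\<exists>m. basis S T (length Ls) (\<lambda>k. fst (w k)) (\<lambda>k. snd (w k)) m"
    using iso_quot_iff_basis[OF S T ST, of "length Ls" "\<lambda>k. fst (w k)" "\<lambda>k. snd (w k)"] iso w X
    by (metis prod.collapse)
  then show "\<exists>n e V m. (\<forall>k<n. (e k, V k) \<in> X) \<and> basis S T n e V m"
    using w by (metis prod.collapse)
next
  assume "\<exists>n e V m. (\<forall>k<n. (e k, V k) \<in> X) \<and> basis S T n e V m"
  then obtain n e V m where X': "\<And>k. k < n \<Longrightarrow> (e k, V k) \<in> X" and b: "basis S T n e V m" by blast
  let ?Ls = "map (\<lambda>k. cyc R (e k) (V k)) [0..<n]"
  have "iso_rmod R (quot R M T S) (dsum {..<n} (\<lambda>k. cyc R (e k) (V k)))"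
    using iso_quot_iff_basis[OF S T ST, of n e V] X X' b by blast
  also have "dsum {..<n} (\<lambda>k. cyc R (e k) (V k)) = dsum {..<n} (nth ?Ls)"
    by (intro dsum_cong) simp
  finally have "iso_rmod R (quot R M T S) (dsum {..<length ?Ls} (nth ?Ls))" by simp
  moreover have "set ?Ls \<subseteq> (\<lambda>(e, V). cyc R e V) ` X" using X' by force
  ultimately show "in_addcls R ((\<lambda>(e, V). cyc R e V) ` X) (quot R M T S)"
    unfolding in_addcls_def by blast
qed

lemma is_zero_quot_iff:
  assumes S: "submod R M S" and T: "submod R M T" and ST: "\<And>x. x \<in> Ob R \<Longrightarrow> S x \<subseteq> T x"
  shows "is_zero_rmod R (quot R M T S) \<longleftrightarrow> (\<forall>x\<in>Ob R. T x = S x)"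
proof -
  have "coset M S x ` T x = {S x} \<longleftrightarrow> T x = S x" if x: "x \<in> Ob R" for x
  proof -
    have "coset M S x t = S x \<longleftrightarrow> t \<in> S x" if "t \<in> T x" for t
      using coset_eq_zero_iff[OF S x submodD(1)[OF T x that]] .
    moreover have "T x \<noteq> {}" using submodD(2)[OF T x] by blast
    ultimately have "coset M S x ` T x = {S x} \<longleftrightarrow> T x \<subseteq> S x" by (auto simp: image_def)
    then show ?thesis using ST[OF x] by blast
  qed
  then show ?thesis unfolding is_zero_rmod_def Mc_quot mzero_quot by simp
qed

section \<open>Finite filtrations built from the bottom\<close>

text \<open>A version of the chain in \<open>in_Ff\<close> that ends at an arbitrary submodule S and
  has an abstract step condition, so that a chain can be prolonged by one term.\<close>

definition filt :: "(('o \<Rightarrow> 'm set) \<Rightarrow> ('o \<Rightarrow> 'm set) \<Rightarrow> bool) \<Rightarrow> ('o \<Rightarrow> 'm set) \<Rightarrow> bool" where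
  "filt P S \<longleftrightarrow> (\<exists>(n::nat) Ch. (\<forall>k\<le>n. submod R M (Ch k)) \<and> (\<forall>x\<in>Ob R. Ch 0 x = {mzero M x}) \<and>
     Ch n = S \<and> (\<forall>k<n. (\<forall>x\<in>Ob R. Ch k x \<subseteq> Ch (Suc k) x) \<and> P (Ch k) (Ch (Suc k))))"

lemma filt_base: "submod R M S \<Longrightarrow> (\<And>x. x \<in> Ob R \<Longrightarrow> S x = {mzero M x}) \<Longrightarrow> filt P S"
  unfolding filt_def by (intro exI[of _ 0] exI[of _ "\<lambda>_. S"]) simp

lemma filt_snoc:
  assumes "filt P A" "submod R M S" "\<And>x. x \<in> Ob R \<Longrightarrow> A x \<subseteq> S x" "P A S"
  shows "filt P S"
proof -
  obtain n Ch where Ch: "\<forall>k\<le>n. submod R M (Ch k)" "\<forall>x\<in>Ob R. Ch 0 x = {mzero M x}" "Ch n = A"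
    "\<forall>k<n. (\<forall>x\<in>Ob R. Ch k x \<subseteq> Ch (Suc k) x) \<and> P (Ch k) (Ch (Suc k))"
    using assms(1) unfolding filt_def by blast
  let ?D = "Ch(Suc n := S)"
  have "\<forall>k\<le>Suc n. submod R M (?D k)" using Ch(1) assms(2) by (simp add: le_Suc_eq)
  moreover have "\<forall>x\<in>Ob R. ?D 0 x = {mzero M x}" using Ch(2) by simp
  moreover have "(\<forall>x\<in>Ob R. ?D k x \<subseteq> ?D (Suc k) x) \<and> P (?D k) (?D (Suc k))" if "k < Suc n" for k
  proof (cases "k = n")
    case True
    then show ?thesis using Ch(3) assms(3,4) by simp
  next
    case False
    then show ?thesis using Ch(4) that by simp
  qed
  ultimately show ?thesis
    unfolding filt_def by (intro exI[of _ "Suc n"] exI[of _ ?D]) simp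
qed

end

context stratified
begin

section \<open>Traces determined by finitely many jumps\<close>

lemma finite_has_max:
  assumes "finite F" "F \<noteq> {}" "F \<subseteq> Field r"
  shows "\<exists>m\<in>F. \<forall>j\<in>F. (j, m) \<in> r"
  using assms
proof (induction rule: finite_ne_induct)
  case (singleton x)
  then show ?case using refl by blast
next
  case (insert x F)
  then obtain m where m: "m \<in> F" "\<forall>j\<in>F. (j, m) \<in> r" by blast
  then show ?case
    using total[of x m] insert.prems refl[of x] trans by blast
qed

lemma wf: "wf (r - Id)"
  using wo by (simp add: well_order_on_def)

abbreviation "jumps \<equiv> {i \<in> Field r. \<exists>x\<in>Ob R. gen (le i) (Mc M) x \<noteq> gen (lt i) (Mc M) x}"

text \<open>Between jumps the trace is constant, also at limits.\<close>

lemma gen_le_bound: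
  assumes N: "submod R M N" and "i \<in> Field r"
    and "\<And>s x. s \<in> jumps \<Longrightarrow> (s, i) \<in> r \<Longrightarrow> x \<in> Ob R \<Longrightarrow> gen (le s) (Mc M) x \<subseteq> N x"
    and "x \<in> Ob R"
  shows "gen (le i) (Mc M) x \<subseteq> N x"
  using wf assms(2-4)
proof (induction i arbitrary: x rule: wf_induct_rule)
  case (less i)
  show ?case
  proof (cases "i \<in> jumps")
    case True
    then show ?thesis by (rule less.prems(2)[OF _ refl[OF less.prems(1)] less.prems(3)])
  next
    case False
    then have eq: "gen (le i) (Mc M) x = gen (lt i) (Mc M) x"
      using less.prems(1,3) by auto
    \<comment> \<open>Each generator of the trace strictly below i sits at some level j < i, where
      the induction hypothesis applies. Successor and limit indices need no distinction.\<close>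
    have "gen (lt i) (Mc M) x \<subseteq> N x"
    proof (rule gen_least[OF N])
      fix e assume e: "e \<in> lt i"
      then obtain j where j: "(j, i) \<in> r" "j \<noteq> i" "e \<in> G j" by (auto simp: lt_def)
      have jF: "j \<in> Field r" using j(1) by (rule FieldI1)
      have "gen (le j) (Mc M) e \<subseteq> N e"
      proof (rule less.IH)
        show "(j, i) \<in> r - Id" using j by blast
        show "gen (le s) (Mc M) x \<subseteq> N x" if "s \<in> jumps" "(s, j) \<in> r" "x \<in> Ob R" for s x
          by (rule less.prems(2)[OF that(1) trans[OF that(2) j(1)] that(3)])
        show "e \<in> Ob R" using e lt_Ob by blast
      qed (rule jF)
      moreover have "e \<in> le j" using G_le[OF refl[OF jF]] j(3) by blast
      ultimately show "Mc M e \<subseteq> N e" using gen_incl[of e "le j" "Mc M"] by blast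
    qed
    then show ?thesis using eq by simp
  qed
qed

text \<open>Every generator strictly below i appears in the trace at some j < i, and the jumps up to
  j are all strictly below i.\<close>

lemma gen_lt_bound:
  assumes N: "submod R M N"
    and "\<And>s x. s \<in> jumps \<Longrightarrow> (s, i) \<in> r \<Longrightarrow> s \<noteq> i \<Longrightarrow> x \<in> Ob R \<Longrightarrow> gen (le s) (Mc M) x \<subseteq> N x"
  shows "gen (lt i) (Mc M) x \<subseteq> N x"
proof (rule gen_least[OF N])
  fix e assume e: "e \<in> lt i"
  then obtain j where j: "(j, i) \<in> r" "j \<noteq> i" "e \<in> G j" by (auto simp: lt_def)
  have jF: "j \<in> Field r" using j(1) by (rule FieldI1)
  have "gen (le j) (Mc M) e \<subseteq> N e"
  proof (rule gen_le_bound[OF N jF])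
    fix s x assume s: "s \<in> jumps" "(s, j) \<in> r" "x \<in> Ob R"
    have "s \<noteq> i" using antisym[OF j(1)] s(2) j(2) by auto
    then show "gen (le s) (Mc M) x \<subseteq> N x" by (rule assms(2)[OF s(1) trans[OF s(2) j(1)] _ s(3)])
  next
    show "e \<in> Ob R" by (rule subsetD[OF lt_Ob e])
  qed
  moreover have "e \<in> le j" using G_le[OF refl[OF jF]] j(3) by blast
  ultimately show "Mc M e \<subseteq> N e" using gen_incl[of e "le j" "Mc M"] by blast
qed

lemma gen_le_submod: "submod R M (gen (le i) (Mc M))" and gen_lt_submod: "submod R M (gen (lt i) (Mc M))"
  by (intro gen_submod submod_self le_Ob lt_Ob)+

lemma gen_lt_le: "gen (lt i) (Mc M) x \<subseteq> gen (le i) (Mc M) x"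
  by (rule gen_mono[OF lt_le]) auto

text \<open>The trace strictly below i equals the trace at the greatest jump m < i, or is zero if
  there is none. A chain for m is thus a chain for the trace strictly below i, and one more term
  reaches i. The chain is finite although the induction is transfinite.\<close>

lemma filt_gen_le:
  assumes fin: "finite jumps"
    and P: "\<And>i. i \<in> Field r \<Longrightarrow> P (gen (lt i) (Mc M)) (gen (le i) (Mc M))"
    and "i \<in> Field r"
  shows "filt P (gen (le i) (Mc M))"
  using wf assms(3)
proof (induction i rule: wf_induct_rule)
  case (less i)
  define F where "F = {s \<in> jumps. (s, i) \<in> r \<and> s \<noteq> i}"
  have "filt P (gen (lt i) (Mc M))"
  proof (cases "F = {}")
    case True
    \<comment> \<open>Without jumps below i the bound is vacuous and may be taken to be the zero
      submodule.\<close>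
    have "gen (lt i) (Mc M) x \<subseteq> {mzero M x}" for x
      using True by (intro gen_lt_bound[where N="\<lambda>x. {mzero M x}"] submod_zero) (auto simp: F_def)
    then show ?thesis
      using submodD(2)[OF gen_lt_submod] by (intro filt_base gen_lt_submod) blast
  next
    case False
    have "finite F" using fin unfolding F_def by (rule rev_finite_subset) blast
    moreover have "F \<subseteq> Field r" unfolding F_def by blast
    ultimately obtain m where m: "m \<in> F" "\<forall>j\<in>F. (j, m) \<in> r" using finite_has_max False by blast
    have mi: "(m, i) \<in> r" "m \<noteq> i" "m \<in> Field r" using m(1) unfolding F_def by blast+
    have "gen (lt i) (Mc M) = gen (le m) (Mc M)"
    proof (intro ext equalityI)
      fix x
      show "gen (lt i) (Mc M) x \<subseteq> gen (le m) (Mc M) x"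
      proof (rule gen_lt_bound[OF gen_le_submod])
        fix s x assume "s \<in> jumps" "(s, i) \<in> r" "s \<noteq> i"
        then have "(s, m) \<in> r" using m(2) unfolding F_def by blast
        then show "gen (le s) (Mc M) x \<subseteq> gen (le m) (Mc M) x"
          by (intro gen_mono le_mono) auto
      qed
      show "gen (le m) (Mc M) x \<subseteq> gen (lt i) (Mc M) x"
        by (intro gen_mono le_lt mi) auto
    qed
    moreover have "filt P (gen (le m) (Mc M))" using less.IH mi by blast
    ultimately show ?thesis by simp
  qed
  \<comment> \<open>The term at i is added even if i is no jump, as P is available at every
    index.\<close>
  then show ?case
    using gen_le_submod gen_lt_le P[OF less.prems] by (rule filt_snoc[of P])
qed

section \<open>Standard modules and the equivalence for generators\<close>

definition std :: "'i \<Rightarrow> ('o, 'h, 'h set) rmod set" where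
  "std i = (\<lambda>e. cyc R e (yo_trace i e)) ` G i"

lemma layer_iff:
  "in_addcls R (std i) (quot R M (gen (le i) (Mc M)) (gen (lt i) (Mc M))) \<longleftrightarrow> layer_basis (Mc M) i"
proof -
  let ?X = "(\<lambda>e. (e, yo_trace i e)) ` G i"
  have D: "std i = (\<lambda>(e, V). cyc R e V) ` ?X" unfolding std_def by (simp add: image_image)
  have "in_addcls R (std i) (quot R M (gen (le i) (Mc M)) (gen (lt i) (Mc M))) \<longleftrightarrow>
     (\<exists>n e V m. (\<forall>k<n. (e k, V k) \<in> ?X) \<and> basis (gen (lt i) (Mc M)) (gen (le i) (Mc M)) n e V m)"
    unfolding D
    by (rule in_addcls_iff_basis[OF gen_lt_submod gen_le_submod gen_lt_le])
      (use G_Ob yo_trace_submod in auto)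
  also have "\<dots> \<longleftrightarrow> layer_basis (Mc M) i"
  proof
    assume "\<exists>n e V m. (\<forall>k<n. (e k, V k) \<in> ?X) \<and> basis (gen (lt i) (Mc M)) (gen (le i) (Mc M)) n e V m"
    then obtain n e V m where X: "\<forall>k<n. (e k, V k) \<in> ?X"
      and b: "basis (gen (lt i) (Mc M)) (gen (le i) (Mc M)) n e V m" by blast
    \<comment> \<open>V is prescribed for k < n only, so it is exchanged for the trace on that
      range.\<close>
    from X have *: "\<forall>k<n. e k \<in> G i" "\<And>k. k < n \<Longrightarrow> V k = yo_trace i (e k)" by auto
    have "basis (gen (lt i) (Mc M)) (gen (le i) (Mc M)) n e (\<lambda>k. yo_trace i (e k)) m"
      using b basis_annihilator_cong[OF *(2)] by simp
    with *(1) show "layer_basis (Mc M) i"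
      unfolding layer_basis_def by (intro exI conjI)
  next
    assume "layer_basis (Mc M) i"
    then obtain n e m where "\<forall>k<n. e k \<in> G i"
      "basis (gen (lt i) (Mc M)) (gen (le i) (Mc M)) n e (\<lambda>k. yo_trace i (e k)) m"
      unfolding layer_basis_def by blast
    then show "\<exists>n e V m. (\<forall>k<n. (e k, V k) \<in> ?X) \<and> basis (gen (lt i) (Mc M)) (gen (le i) (Mc M)) n e V m"
      by (intro exI[of _ n] exI[of _ e] exI[of _ "\<lambda>k. yo_trace i (e k)"] exI[of _ m]) simp
  qed
  finally show ?thesis .
qed

text \<open>One step of a filtration may mix standard modules of several levels. It is refined into
  cyclic extensions, each of which is treated with the level of its own generator.\<close>

lemma layered_quot_step:
  assumes A: "submod R M A" and S: "submod R M S" and AS: "\<And>x. x \<in> Ob R \<Longrightarrow> A x \<subseteq> S x"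
    and q: "in_addcls R (\<Union>i\<in>Field r. std i) (quot R M S A)" and g: "layered A"
  shows "layered S"
proof -
  let ?X = "{(e, yo_trace i e) | e i. i \<in> Field r \<and> e \<in> G i}"
  have D: "(\<Union>i\<in>Field r. std i) = (\<lambda>(e, V). cyc R e V) ` ?X"
    unfolding std_def by (auto simp: image_iff)
  have "\<exists>n e V m. (\<forall>k<n. (e k, V k) \<in> ?X) \<and> basis A S n e V m"
    using q unfolding D
    by (subst (asm) in_addcls_iff_basis[OF A S AS]) (use G_Ob yo_trace_submod in auto)
  then obtain n e V m where X: "\<And>k. k < n \<Longrightarrow> (e k, V k) \<in> ?X" and b: "basis A S n e V m" by blast
  show ?thesis
  proof (rule basis_chain_induct[OF A S AS b])
    show "submod R (Yo R (e k)) (V k)" if "k < n" for k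
    proof -
      obtain i where "e k \<in> G i" "V k = yo_trace i (e k)" using X[OF \<open>k < n\<close>] by blast
      then show ?thesis using yo_trace_submod[of "e k" i] G_Ob[of i] by auto
    qed
    show "layered A''" if "layered A'" "\<And>x. x \<in> Ob R \<Longrightarrow> A' x = A'' x" for A' A''
      using layered_cong that by blast
    show "layered A''" if h: "submod R M A'" "submod R M A''" "\<And>x. x \<in> Ob R \<Longrightarrow> A' x \<subseteq> A'' x" "k < n"
      "cyclic_ext A' A'' (e k) (V k) (m k)" "layered A'" for A' A'' k
    proof -
      obtain i where i: "i \<in> Field r" "e k \<in> G i" "V k = yo_trace i (e k)" using X[OF h(4)] by blast
      interpret cyclic_step R M r G A' A'' i "e k" "m k"
        by unfold_locales (use h i in auto)
      show ?thesis by (rule layered_step[OF h(6)])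
    qed
  qed (use g in simp_all)
qed

lemma in_Ff_iff:
  assumes "Field r \<noteq> {}"
  shows "in_Ff R (\<Union>i\<in>Field r. std i) M \<longleftrightarrow> layered (Mc M)"
proof
  assume "in_Ff R (\<Union>i\<in>Field r. std i) M"
  then obtain n Ch where sub: "\<forall>k\<le>n. submod R M (Ch k)"
    and ends: "\<forall>x\<in>Ob R. Ch 0 x = {mzero M x} \<and> Ch n x = Mc M x"
    and step: "\<forall>k<n. (\<forall>x\<in>Ob R. Ch k x \<subseteq> Ch (Suc k) x) \<and>
      in_addcls R (\<Union>i\<in>Field r. std i) (quot R M (Ch (Suc k)) (Ch k))"
    unfolding in_Ff_def by (elim exE conjE) (rule that)
  have "layered (Ch k)" if "k \<le> n" for k
    using that
  proof (induction k)
    case 0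
    show ?case by (rule layered_cong[OF layered_zero[OF assms]]) (use ends in simp)
  next
    case (Suc k)
    then show ?case
      by (intro layered_quot_step[of "Ch k" "Ch (Suc k)"]) (use sub step in simp_all)
  qed
  then show "layered (Mc M)" using layered_cong[of "Ch n"] ends by auto
next
  assume g: "layered (Mc M)"
  let ?P = "\<lambda>A S. in_addcls R (\<Union>i\<in>Field r. std i) (quot R M S A)"
  have mono: "in_addcls R (\<Union>i\<in>Field r. std i) N" if d: "in_addcls R (std i) N" and i: "i \<in> Field r"
    for i and N :: "('o, 'h, 'm set) rmod"
  proof -
    obtain Ls where "set Ls \<subseteq> std i" "iso_rmod R N (dsum {..<length Ls} (nth Ls))"
      using d unfolding in_addcls_def by blast
    then show ?thesis using i unfolding in_addcls_def by (intro exI[of _ Ls]) blast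
  qed
  obtain i0 where i0: "i0 \<in> Field r" "\<And>x. x \<in> Ob R \<Longrightarrow> gen (le i0) (Mc M) x = Mc M x"
    using g unfolding layered_def by blast
  have "filt ?P (gen (le i0) (Mc M))"
  proof (rule filt_gen_le[OF _ _ i0(1)])
    show "finite jumps" using g unfolding layered_def by blast
    show "?P (gen (lt i) (Mc M)) (gen (le i) (Mc M))" if "i \<in> Field r" for i
      using g that unfolding layered_def by (intro mono[OF _ that]) (simp add: layer_iff)
  qed
  then obtain n Ch where "\<forall>k\<le>n. submod R M (Ch k)" "\<forall>x\<in>Ob R. Ch 0 x = {mzero M x}"
    "Ch n = gen (le i0) (Mc M)" "\<forall>k<n. (\<forall>x\<in>Ob R. Ch k x \<subseteq> Ch (Suc k) x) \<and> ?P (Ch k) (Ch (Suc k))"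
    unfolding filt_def by (elim exE conjE) (rule that)
  then show "in_Ff R (\<Union>i\<in>Field r. std i) M"
    unfolding in_Ff_def using i0(2) by (intro exI[of _ n] exI[of _ Ch]) simp
qed

end

text \<open>The class contains the object defining it, through the identity, so the choice in
  \<open>rep\<close> is made from a nonempty set of objects.\<close>

lemma rep_Ob:
  assumes "K_ringoid R" "c \<in> sect R r B i"
  shows "rep c \<in> Ob R"
proof -
  obtain e where c: "c = isocl R e" "e \<in> Ob R"
    using assms(2) unfolding sect_def indc_def local_obj_def by blast
  then have "e \<in> c"
    using id_closed[OF assms(1) c(2)] cmp_id[OF assms(1) c(2) c(2)] unfolding isocl_def iso_obj_def by auto
  then have "rep c \<in> c" unfolding rep_def by (rule someI)
  then show ?thesis using c by (simp add: isocl_def)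
qed

theorem theorem4p8:
  fixes R :: "('o, 'h, 'k::comm_ring_1) ringoid"
    and r :: "'i rel" and B :: "'i \<Rightarrow> 'o set"
    and M :: "('o, 'h, 'm) rmod"
  assumes "locally_finite R"
    and "exh_adm R r B"
    and "Field r \<noteq> {}"
    and "is_rmod R M"
  shows "in_Ff R (Delta_all R r B) M \<longleftrightarrow>
    ((\<exists>i0\<in>Field r. \<forall>j\<in>Field r. (i0, j) \<in> r \<longrightarrow> (\<forall>x\<in>Ob R. tau R r B j M x = Mc M x)) \<and>
     finite {i \<in> Field r. \<not> is_zero_rmod R (quot R M (tau R r B i M) (taubar R r B i M))} \<and>
     (\<forall>i\<in>Field r. in_addcls R (Delta R r B i) (quot R M (tau R r B i M) (taubar R r B i M))))"
proof -
  have R: "K_ringoid R" using assms(1) by (simp add: locally_finite_def)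
  interpret stratified R M r "\<lambda>i. rep ` sect R r B i"
  proof
    show "Well_order r" using assms(2) by (simp add: exh_adm_def)
    show "rep ` sect R r B i \<subseteq> Ob R" for i using rep_Ob[OF R, of _ r B i] by blast
  qed (fact R, fact assms(4))
  have tau: "tau R r B i M = gen (le i) (Mc M)" and taubar: "taubar R r B i M = gen (lt i) (Mc M)" for i
    unfolding tau_def taubar_def Pbar_def le_def lt_def
    by (intro trace_dsum_Yo rep_Ob[OF R]; assumption)+
  \<comment> \<open>The trace formula is used a second time, now for the representable module in
    place of M.\<close>
  have "taubar R r B i (Yo R e) = yo_trace i e" if "e \<in> Ob R" for i e
  proof -
    interpret Y: rmodule R "Yo R e" by (rule Yo_rmodule[OF R that])
    show ?thesis
      unfolding taubar_def Pbar_def yo_trace_def lt_def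
      using Y.trace_dsum_Yo[of "{j. (j, i) \<in> r \<and> j \<noteq> i}" "sect R r B" rep] rep_Ob[OF R, of _ r B]
      by simp
  qed
  then have "Delta R r B i = std i" for i
    unfolding Delta_def std_def Delta_e_def cyc_def image_image using rep_Ob[OF R, of _ r B]
    by (intro image_cong refl) auto
  then have Delta: "Delta R r B = std" by blast
  \<comment> \<open>Traces increase with the index and stay inside M, so reaching M at one index
    means reaching it at all later ones.\<close>
  have top: "(\<exists>i0\<in>Field r. \<forall>j\<in>Field r. (i0, j) \<in> r \<longrightarrow> (\<forall>x\<in>Ob R. gen (le j) (Mc M) x = Mc M x)) \<longleftrightarrow>
     (\<exists>i0\<in>Field r. \<forall>x\<in>Ob R. gen (le i0) (Mc M) x = Mc M x)"
  proof
    assume "\<exists>i0\<in>Field r. \<forall>x\<in>Ob R. gen (le i0) (Mc M) x = Mc M x"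
    then obtain i0 where i0: "i0 \<in> Field r" "\<forall>x\<in>Ob R. gen (le i0) (Mc M) x = Mc M x" by blast
    have "gen (le j) (Mc M) x = Mc M x" if "(i0, j) \<in> r" "x \<in> Ob R" for j x
    proof
      show "gen (le j) (Mc M) x \<subseteq> Mc M x" by (rule gen_least[OF submod_self]) auto
      show "Mc M x \<subseteq> gen (le j) (Mc M) x"
        using gen_mono[OF le_mono[OF that(1)], of "Mc M" "Mc M" x] i0(2) that(2) by simp
    qed
    then show "\<exists>i0\<in>Field r. \<forall>j\<in>Field r. (i0, j) \<in> r \<longrightarrow> (\<forall>x\<in>Ob R. gen (le j) (Mc M) x = Mc M x)"
      using i0(1) by blast
  qed (use refl in blast)
  have "is_zero_rmod R (quot R M (gen (le i) (Mc M)) (gen (lt i) (Mc M))) \<longleftrightarrow>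
      (\<forall>x\<in>Ob R. gen (le i) (Mc M) x = gen (lt i) (Mc M) x)" for i
    by (rule is_zero_quot_iff[OF gen_lt_submod gen_le_submod gen_lt_le])
  then show ?thesis
    unfolding Delta_all_def tau taubar Delta in_Ff_iff[OF assms(3)] layered_def top layer_iff by simp
qed

end
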